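(* Let $M$ be a compact manifold with a Riemannian metric $g_0$, let $\mathcal F$ be a (non-singular) Riemannian foliation on $(M,g_0)$ with totally geodesic leaves, and let $\phi:M\to\mathbb R$ be a basic function. Let $g_\phi$ be the metric defined by $$g_\phi(X+\xi,X+\xi)=g_0(X,X)+e^{2\phi}g_0(\xi,\xi)$$ for $X$ horizontal and $\xi$ vertical. If $g_\phi$ is positively curved (has positive sectional curvature), then the dimension of $M$ is smaller than twice the codimension of $\mathcal F$: $\dim M<2\operatorname{codim}\mathcal F$.
   Context: A foliation $\mathcal F$ on $(M,g_0)$ is Riemannian if its leaves are locally equidistant (equivalently, $\mathcal F$ is locally given by the fibers of a Riemannian submersion). All foliations are non-singular: all leaves have the same dimension. Vertical vectors are those tangent to the leaves; horizontal vectors are those $g_0$-orthogonal to the leaves. A basic function is a smooth function that is constant along the leaves.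
   Formalization: The codimension of the foliation is assumed to be at least 1 and M to be nonempty; in codimension 0 (for example the round sphere with a single leaf and constant φ) the claim dim M < 2 codim F is false. *)

theory Defs
  imports "HOL-Analysis.Analysis"
begin

section \<open>Smooth maps between Euclidean spaces\<close>

text \<open>Only meaningful on open sets \<open>S\<close>, the only case used below.\<close>

fun Ck_on :: "nat \<Rightarrow> ('a::real_normed_vector \<Rightarrow> 'b::real_normed_vector) \<Rightarrow> 'a set \<Rightarrow> bool" where
  "Ck_on 0 f S \<longleftrightarrow> continuous_on S f"
| "Ck_on (Suc k) f S \<longleftrightarrow>
     (\<forall>x\<in>S. f differentiable (at x)) \<and>
     (\<forall>v. Ck_on k (\<lambda>x. frechet_derivative f (at x) v) S)"

definition smooth_on :: "'a set \<Rightarrow> ('a::real_normed_vector \<Rightarrow> 'b::real_normed_vector) \<Rightarrow> bool" where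
  "smooth_on S f \<longleftrightarrow> (\<forall>k. Ck_on k f S)"


section \<open>Smooth manifolds\<close>

text \<open>A chart is a pair of its domain and its coordinate map; the values of the
  coordinate map outside the domain are irrelevant.\<close>

type_synonym ('m, 'e) chart = "'m set \<times> ('m \<Rightarrow> 'e)"

abbreviation dom_of :: "('m, 'e) chart \<Rightarrow> 'm set" where "dom_of c \<equiv> fst c"

abbreviation coords :: "('m, 'e) chart \<Rightarrow> 'm \<Rightarrow> 'e" where "coords c \<equiv> snd c"

definition chart_inv :: "('m, 'e) chart \<Rightarrow> 'e \<Rightarrow> 'm" where
  "chart_inv c = inv_into (dom_of c) (coords c)"

definition is_chart :: "'m topology \<Rightarrow> ('m, 'e::euclidean_space) chart \<Rightarrow> bool" where
  "is_chart M c \<longleftrightarrow>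
     openin M (dom_of c) \<and> open (coords c ` dom_of c) \<and>
     homeomorphic_map (subtopology M (dom_of c)) (top_of_set (coords c ` dom_of c)) (coords c)"

definition transition :: "('m, 'e) chart \<Rightarrow> ('m, 'e) chart \<Rightarrow> 'e \<Rightarrow> 'e" where
  "transition c d = coords d \<circ> chart_inv c"

definition compatible :: "('m, 'e::euclidean_space) chart \<Rightarrow> ('m, 'e) chart \<Rightarrow> bool" where
  "compatible c d \<longleftrightarrow>
     smooth_on (coords c ` (dom_of c \<inter> dom_of d)) (transition c d) \<and>
     smooth_on (coords d ` (dom_of c \<inter> dom_of d)) (transition d c)"

text \<open>The smooth structure \<open>A\<close> is a maximal smooth atlas; the dimension of the manifold
  is \<open>DIM('e)\<close>.\<close>

definition smooth_manifold :: "'m topology \<Rightarrow> ('m, 'e::euclidean_space) chart set \<Rightarrow> bool" where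
  "smooth_manifold M A \<longleftrightarrow>
     Hausdorff_space M \<and> second_countable M \<and>
     (\<forall>c\<in>A. is_chart M c) \<and> (\<Union>c\<in>A. dom_of c) = topspace M \<and>
     (\<forall>c\<in>A. \<forall>d\<in>A. compatible c d) \<and>
     (\<forall>c. is_chart M c \<and> (\<forall>d\<in>A. compatible c d) \<longrightarrow> c \<in> A)"

definition charts_at :: "('m, 'e) chart set \<Rightarrow> 'm \<Rightarrow> ('m, 'e) chart set" where
  "charts_at A p = {c \<in> A. p \<in> dom_of c}"

definition smooth_map_on ::
    "('m, 'e::euclidean_space) chart set \<Rightarrow> 'm set \<Rightarrow> ('m \<Rightarrow> 'b::real_normed_vector) \<Rightarrow> bool" where
  "smooth_map_on A U f \<longleftrightarrow>
     (\<forall>c\<in>A. smooth_on (coords c ` (U \<inter> dom_of c)) (f \<circ> chart_inv c))"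

text \<open>A tangent vector at \<open>p\<close> is the family of its components in all charts at \<open>p\<close>,
  subject to the transformation law (and set to zero in the other charts, so that equality of
  tangent vectors is equality of functions). Addition is pointwise.\<close>

type_synonym ('m, 'e) tangent = "('m, 'e) chart \<Rightarrow> 'e"

definition tangent_space ::
    "('m, 'e::euclidean_space) chart set \<Rightarrow> 'm \<Rightarrow> ('m, 'e) tangent set" where
  "tangent_space A p =
     {v. (\<forall>c\<in>charts_at A p. \<forall>d\<in>charts_at A p.
            v d = frechet_derivative (transition c d) (at (coords c p)) (v c)) \<and>
         (\<forall>c. c \<notin> charts_at A p \<longrightarrow> v c = 0)}"

definition tangent_add :: "('m, 'e::euclidean_space) tangent \<Rightarrow> ('m, 'e) tangent \<Rightarrow> ('m, 'e) tangent"
    (infixl "+\<^sub>T" 65) where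
  "v +\<^sub>T w = (\<lambda>c. v c + w c)"

text \<open>The tangent vector at \<open>p\<close> with components \<open>a\<close> in the chart \<open>c\<close>.\<close>

definition coord_vector ::
    "('m, 'e::euclidean_space) chart set \<Rightarrow> ('m, 'e) chart \<Rightarrow> 'm \<Rightarrow> 'e \<Rightarrow> ('m, 'e) tangent" where
  "coord_vector A c p a =
     (\<lambda>d. if d \<in> charts_at A p
          then frechet_derivative (transition c d) (at (coords c p)) a else 0)"

text \<open>The differential of \<open>f\<close> at \<open>p\<close>, computed in the chart \<open>c\<close> at \<open>p\<close>; the result does
  not depend on \<open>c\<close>.\<close>

definition differential ::
    "('m, 'e::euclidean_space) chart \<Rightarrow> ('m \<Rightarrow> 'b::real_normed_vector) \<Rightarrow> 'm \<Rightarrow> ('m, 'e) tangent \<Rightarrow> 'b"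
  where
  "differential c f p v = frechet_derivative (f \<circ> chart_inv c) (at (coords c p)) (v c)"


section \<open>Riemannian metrics and sectional curvature\<close>

definition metric_on :: "'e set \<Rightarrow> ('e::euclidean_space \<Rightarrow> 'e \<Rightarrow> 'e \<Rightarrow> real) \<Rightarrow> bool" where
  "metric_on S G \<longleftrightarrow>
     (\<forall>x\<in>S. bilinear (G x) \<and> (\<forall>a b. G x a b = G x b a) \<and> (\<forall>a. a \<noteq> 0 \<longrightarrow> 0 < G x a a)) \<and>
     (\<forall>a b. smooth_on S (\<lambda>x. G x a b))"

type_synonym ('m, 'e) metric_tensor = "'m \<Rightarrow> ('m, 'e) tangent \<Rightarrow> ('m, 'e) tangent \<Rightarrow> real"

definition coord_metric ::
    "('m, 'e::euclidean_space) chart set \<Rightarrow> ('m, 'e) metric_tensor \<Rightarrow> ('m, 'e) chart \<Rightarrow>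
     'e \<Rightarrow> 'e \<Rightarrow> 'e \<Rightarrow> real" where
  "coord_metric A g c x a b =
     g (chart_inv c x) (coord_vector A c (chart_inv c x) a) (coord_vector A c (chart_inv c x) b)"

text \<open>Every tangent vector at a point of the domain of \<open>c\<close> is a \<^const>\<open>coord_vector\<close> of \<open>c\<close>,
  so this says that \<open>g p\<close> is an inner product on the tangent space at \<open>p\<close>, depending smoothly
  on \<open>p\<close>.\<close>

definition riemannian_metric ::
    "('m, 'e::euclidean_space) chart set \<Rightarrow> ('m, 'e) metric_tensor \<Rightarrow> bool" where
  "riemannian_metric A g \<longleftrightarrow> (\<forall>c\<in>A. metric_on (coords c ` dom_of c) (coord_metric A g c))"

text \<open>Levi-Civita connection of a metric \<open>G\<close> on an open subset of a Euclidean space.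
  The Christoffel symbol \<open>christoffel G x a b\<close> is the covariant derivative at \<open>x\<close> of the
  constant field \<open>b\<close> in direction \<open>a\<close>, given by the Koszul formula.\<close>

definition christoffel :: "('e::euclidean_space \<Rightarrow> 'e \<Rightarrow> 'e \<Rightarrow> real) \<Rightarrow> 'e \<Rightarrow> 'e \<Rightarrow> 'e \<Rightarrow> 'e" where
  "christoffel G x a b =
     (THE w. \<forall>z. 2 * G x w z =
          frechet_derivative (\<lambda>y. G y b z) (at x) a
        + frechet_derivative (\<lambda>y. G y a z) (at x) b
        - frechet_derivative (\<lambda>y. G y a b) (at x) z)"

definition cov_deriv ::
    "('e::euclidean_space \<Rightarrow> 'e \<Rightarrow> 'e \<Rightarrow> real) \<Rightarrow> ('e \<Rightarrow> 'e) \<Rightarrow> ('e \<Rightarrow> 'e) \<Rightarrow> 'e \<Rightarrow> 'e" where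
  "cov_deriv G X Y x = frechet_derivative Y (at x) (X x) + christoffel G x (X x) (Y x)"

text \<open>\<open>R(a,b)w\<close>; there is no bracket term because constant fields commute.\<close>

definition curvature ::
    "('e::euclidean_space \<Rightarrow> 'e \<Rightarrow> 'e \<Rightarrow> real) \<Rightarrow> 'e \<Rightarrow> 'e \<Rightarrow> 'e \<Rightarrow> 'e \<Rightarrow> 'e" where
  "curvature G x a b w =
     cov_deriv G (\<lambda>_. a) (cov_deriv G (\<lambda>_. b) (\<lambda>_. w)) x
   - cov_deriv G (\<lambda>_. b) (cov_deriv G (\<lambda>_. a) (\<lambda>_. w)) x"

definition sectional_curvature ::
    "('e::euclidean_space \<Rightarrow> 'e \<Rightarrow> 'e \<Rightarrow> real) \<Rightarrow> 'e \<Rightarrow> 'e \<Rightarrow> 'e \<Rightarrow> real" where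
  "sectional_curvature G x a b =
     G x (curvature G x a b b) a / (G x a a * G x b b - (G x a b)\<^sup>2)"

text \<open>Sectional curvature does not depend on the chart in which it is computed, so quantifying
  over all charts at a point is the same as choosing one. The same applies to the covariant
  derivative in the definition of totally geodesic leaves below.\<close>

definition positively_curved ::
    "('m, 'e::euclidean_space) chart set \<Rightarrow> ('m, 'e) metric_tensor \<Rightarrow> bool" where
  "positively_curved A g \<longleftrightarrow>
     (\<forall>c\<in>A. \<forall>p\<in>dom_of c. \<forall>a b. a \<noteq> b \<and> independent {a, b} \<longrightarrow>
        0 < sectional_curvature (coord_metric A g c) (coords c p) a b)"


section \<open>Foliations\<close>

text \<open>A foliation is given by its set \<open>F\<close> of leaves. The linear surjection \<open>pr\<close> plays the role
  of the standard projection from R^n to R^q in the usual definition (all linear surjections are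
  equivalent up to a linear change of coordinates): in a foliated chart, the connected components
  of the intersection of a leaf with the chart domain (the plaques) are the level sets of \<open>pr\<close> in
  the coordinates. The codimension is \<open>DIM('b)\<close>, and is therefore positive. The leaves may have
  dimension 0. Path connectedness, rather than connectedness, in the topology of \<open>M\<close> is required
  of the leaves because a union of several dense leaves is connected.\<close>

definition fibres_are_plaques ::
    "'m topology \<Rightarrow> 'm set set \<Rightarrow> 'm set \<Rightarrow> ('m \<Rightarrow> 'b) \<Rightarrow> bool" where
  "fibres_are_plaques M F U f \<longleftrightarrow>
     (\<forall>L\<in>F. \<forall>p\<in>U \<inter> L.
        connected_component_of_set (subtopology M (U \<inter> L)) p = {q \<in> U. f q = f p})"

definition foliated_chart ::
    "'m topology \<Rightarrow> ('m, 'e::euclidean_space) chart set \<Rightarrow> ('e \<Rightarrow> 'b::euclidean_space) \<Rightarrow>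
     'm set set \<Rightarrow> ('m, 'e) chart \<Rightarrow> bool" where
  "foliated_chart M A pr F c \<longleftrightarrow> c \<in> A \<and> fibres_are_plaques M F (dom_of c) (pr \<circ> coords c)"

definition foliation ::
    "'m topology \<Rightarrow> ('m, 'e::euclidean_space) chart set \<Rightarrow> ('e \<Rightarrow> 'b::euclidean_space) \<Rightarrow>
     'm set set \<Rightarrow> bool" where
  "foliation M A pr F \<longleftrightarrow>
     linear pr \<and> surj pr \<and> partition_on (topspace M) F \<and> (\<forall>L\<in>F. path_connectedin M L) \<and>
     (\<forall>p\<in>topspace M. \<exists>c. foliated_chart M A pr F c \<and> p \<in> dom_of c)"

text \<open>Vectors tangent to the leaf through \<open>p\<close>, i.e. to the plaque of a foliated chart at \<open>p\<close>
  (plaques of two foliated charts coincide near \<open>p\<close>).\<close>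

definition vertical ::
    "'m topology \<Rightarrow> ('m, 'e::euclidean_space) chart set \<Rightarrow> ('e \<Rightarrow> 'b::euclidean_space) \<Rightarrow>
     'm set set \<Rightarrow> 'm \<Rightarrow> ('m, 'e) tangent set" where
  "vertical M A pr F p =
     {v \<in> tangent_space A p.
        \<exists>c. foliated_chart M A pr F c \<and> p \<in> dom_of c \<and> pr (v c) = 0}"

definition horizontal ::
    "'m topology \<Rightarrow> ('m, 'e::euclidean_space) chart set \<Rightarrow> ('e \<Rightarrow> 'b::euclidean_space) \<Rightarrow>
     'm set set \<Rightarrow> ('m, 'e) metric_tensor \<Rightarrow> 'm \<Rightarrow> ('m, 'e) tangent set" where
  "horizontal M A pr F g p =
     {v \<in> tangent_space A p. \<forall>w\<in>vertical M A pr F p. g p v w = 0}"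

definition basic_function ::
    "'m topology \<Rightarrow> ('m, 'e::euclidean_space) chart set \<Rightarrow> 'm set set \<Rightarrow> ('m \<Rightarrow> real) \<Rightarrow> bool" where
  "basic_function M A F \<phi> \<longleftrightarrow>
     smooth_map_on A (topspace M) \<phi> \<and> (\<forall>L\<in>F. \<forall>p\<in>L. \<forall>q\<in>L. \<phi> p = \<phi> q)"

text \<open>\<open>f\<close> is a Riemannian submersion from \<open>(U, g)\<close> onto the open subset \<open>f ` U\<close> of a Euclidean
  space, equipped with the Riemannian metric \<open>h\<close>.\<close>

definition riemannian_submersion ::
    "('m, 'e::euclidean_space) chart set \<Rightarrow> ('m, 'e) metric_tensor \<Rightarrow> 'm set \<Rightarrow>
     ('m \<Rightarrow> 'b::euclidean_space) \<Rightarrow> ('b \<Rightarrow> 'b \<Rightarrow> 'b \<Rightarrow> real) \<Rightarrow> bool" where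
  "riemannian_submersion A g U f h \<longleftrightarrow>
     smooth_map_on A U f \<and> open (f ` U) \<and> metric_on (f ` U) h \<and>
     (\<forall>p\<in>U. \<forall>c\<in>charts_at A p.
        differential c f p ` tangent_space A p = UNIV \<and>
        (\<forall>v\<in>tangent_space A p.
           (\<forall>w\<in>tangent_space A p. differential c f p w = 0 \<longrightarrow> g p v w = 0) \<longrightarrow>
           h (f p) (differential c f p v) (differential c f p v) = g p v v))"

text \<open>The base of a local Riemannian submersion may be taken to be a coordinate domain.\<close>

definition riemannian_foliation ::
    "'m topology \<Rightarrow> ('m, 'e::euclidean_space) chart set \<Rightarrow> ('e \<Rightarrow> 'b::euclidean_space) \<Rightarrow>
     'm set set \<Rightarrow> ('m, 'e) metric_tensor \<Rightarrow> bool" where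
  "riemannian_foliation M A pr F g \<longleftrightarrow>
     foliation M A pr F \<and>
     (\<forall>p\<in>topspace M. \<exists>U. \<exists>f :: 'm \<Rightarrow> 'b. \<exists>h.
        openin M U \<and> p \<in> U \<and> riemannian_submersion A g U f h \<and> fibres_are_plaques M F U f)"

text \<open>The second fundamental form of the leaves vanishes: the covariant derivative of vertical
  fields is vertical. Fields on a chart domain are given by their components.\<close>

definition totally_geodesic_leaves ::
    "'m topology \<Rightarrow> ('m, 'e::euclidean_space) chart set \<Rightarrow> ('e \<Rightarrow> 'b::euclidean_space) \<Rightarrow>
     'm set set \<Rightarrow> ('m, 'e) metric_tensor \<Rightarrow> bool" where
  "totally_geodesic_leaves M A pr F g \<longleftrightarrow>
     (\<forall>c\<in>A. \<forall>X Y.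
        smooth_on (coords c ` dom_of c) X \<and> smooth_on (coords c ` dom_of c) Y \<and>
        (\<forall>p\<in>dom_of c. coord_vector A c p (X (coords c p)) \<in> vertical M A pr F p \<and>
                      coord_vector A c p (Y (coords c p)) \<in> vertical M A pr F p) \<longrightarrow>
        (\<forall>p\<in>dom_of c.
           coord_vector A c p (cov_deriv (coord_metric A g c) X Y (coords c p))
             \<in> vertical M A pr F p))"

text \<open>The metric obtained from \<open>g\<^sub>0\<close> by rescaling the leaves by \<open>exp \<phi>\<close>. A Riemannian
  metric is determined by its quadratic form, so the formula determines \<open>g\<close> on tangent vectors.\<close>

definition vertical_rescaling ::
    "'m topology \<Rightarrow> ('m, 'e::euclidean_space) chart set \<Rightarrow> ('e \<Rightarrow> 'b::euclidean_space) \<Rightarrow>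
     'm set set \<Rightarrow> ('m, 'e) metric_tensor \<Rightarrow> ('m \<Rightarrow> real) \<Rightarrow> ('m, 'e) metric_tensor \<Rightarrow> bool" where
  "vertical_rescaling M A pr F g\<^sub>0 \<phi> g \<longleftrightarrow>
     riemannian_metric A g \<and>
     (\<forall>p\<in>topspace M. \<forall>X\<in>horizontal M A pr F g\<^sub>0 p. \<forall>\<xi>\<in>vertical M A pr F p.
        g p (X +\<^sub>T \<xi>) (X +\<^sub>T \<xi>) = g\<^sub>0 p X X + exp (2 * \<phi> p) * g\<^sub>0 p \<xi> \<xi>)"

end

theory Submission
  imports Defs
begin

text \<open>
  Let \<open>p\<close> be a minimum of \<open>\<phi>\<close>, which exists by compactness. There \<open>d\<phi> = 0\<close> and
  \<open>Hess \<phi> \<ge> 0\<close>, and for a horizontal \<open>a\<close> and a vertical \<open>v\<close> at \<open>p\<close> the numerator of the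
  sectional curvature of \<open>g\<^sub>\<phi>\<close> is
  \<open>- Hess(e\<^sup>2\<^sup>\<phi>)(a,a) g\<^sub>0(v,v) / 2 + \<bar>H\<bar>\<^sup>2\<close>, where \<open>H\<close> is the horizontal part of
  \<open>\<Gamma>(a,v)\<close>, given by the O'Neill tensor. Hence \<open>v \<mapsto> H\<close> is injective on vertical
  vectors. Its values are orthogonal to \<open>a\<close>, so the leaves have dimension less than the
  codimension.

  All computations take place in one foliated chart at \<open>p\<close>, with constant coordinate vector
  fields. The variation of the horizontal distribution is never differentiated: instead, the
  horizontal part of \<open>a\<close> has constant length along the leaf, so that by Cauchy-Schwarz
  \<open>g\<^sub>\<phi>(a,u)\<^sup>2 \<le> (g\<^sub>\<phi>(a,a) - const) g\<^sub>\<phi>(u,u)\<close> along the leaf for every vertical \<open>u\<close>, with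
  equality at \<open>p\<close>. The second derivative test applied to the difference, with
  \<open>u = \<Gamma>(a,v)\<close>, gives the sign of the curvature when \<open>H = 0\<close>.
\<close>

section \<open>Calculus along lines\<close>

lemma smooth_on_differentiable:
  assumes "smooth_on S f" "x \<in> S"
  shows "f differentiable (at x)"
  using assms Ck_on.simps(2)[of 0 f S] unfolding smooth_on_def by blast

lemma smooth_on_derivative:
  assumes "smooth_on S f"
  shows "smooth_on S (\<lambda>x. frechet_derivative f (at x) v)"
  using assms Ck_on.simps(2) unfolding smooth_on_def by blast

lemma smooth_on_has_derivative:
  assumes "smooth_on S f" "x \<in> S"
  shows "(f has_derivative frechet_derivative f (at x)) (at x)"
  using smooth_on_differentiable[OF assms] frechet_derivative_works by blast

lemma frechet_derivative_eqI: "(f has_derivative f') (at x) \<Longrightarrow> frechet_derivative f (at x) = f'"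
  using frechet_derivative_at by metis

lemma eventually_line_open:
  fixes x v :: "'a::real_normed_vector"
  assumes "open S" "x \<in> S"
  shows "\<forall>\<^sub>F t in at (0::real). x + t *\<^sub>R v \<in> S"
proof (rule topological_tendstoD[OF _ assms(1)])
  show "((\<lambda>t. x + t *\<^sub>R v) \<longlongrightarrow> x + 0 *\<^sub>R v) (at 0)"
    by (intro tendsto_intros)
qed (use assms in simp)

text \<open>Restriction to the line through \<open>p\<close> with direction \<open>v\<close> reduces
  this to one variable: a negative \<open>D2 v\<close> would make the first derivative negative just
  after \<open>0\<close>, and the mean value theorem would give a value below the minimum.
  Minimality is asked along this line only, because some functions below are controlled only along a
  leaf.\<close>

lemma second_derivative_test:
  fixes \<psi> :: "'e::real_normed_vector \<Rightarrow> real"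
  assumes S: "open S" "p \<in> S"
    and d1: "\<And>x. x \<in> S \<Longrightarrow> (\<psi> has_derivative D x) (at x)"
    and d2: "((\<lambda>x. D x v) has_derivative D2) (at p)"
    and min: "\<forall>\<^sub>F t in at 0. \<psi> p \<le> \<psi> (p + t *\<^sub>R v)"
  shows "D p v = 0" "0 \<le> D2 v"
proof -
  let ?z = "\<lambda>t. \<psi> (p + t *\<^sub>R v)"
  obtain e where e: "e > 0" "\<And>t. \<bar>t\<bar> < e \<Longrightarrow> p + t *\<^sub>R v \<in> S \<and> \<psi> p \<le> ?z t"
  proof -
    have "\<forall>\<^sub>F t in at 0. p + t *\<^sub>R v \<in> S \<and> \<psi> p \<le> ?z t"
      using eventually_conj[OF eventually_line_open[OF S] min] .
    then obtain e where "e > 0" "\<And>t. t \<noteq> 0 \<Longrightarrow> \<bar>t\<bar> < e \<Longrightarrow> p + t *\<^sub>R v \<in> S \<and> \<psi> p \<le> ?z t"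
      by (auto simp: eventually_at dist_real_def)
    then show thesis using that[of e] S(2) by (metis add.right_neutral order_refl scaleR_zero_left)
  qed
  have dz: "(?z has_real_derivative D (p + t *\<^sub>R v) v) (at t)" if "\<bar>t\<bar> < e" for t
  proof -
    have "((\<lambda>t. p + t *\<^sub>R v) has_derivative (\<lambda>h. h *\<^sub>R v)) (at t)"
      by (auto intro!: derivative_eq_intros)
    from has_derivative_compose[OF this d1[of "p + t *\<^sub>R v"]] e(2)[OF that]
    have *: "(?z has_derivative (\<lambda>h. D (p + t *\<^sub>R v) (h *\<^sub>R v))) (at t)" by simp
    interpret bounded_linear "D (p + t *\<^sub>R v)"
      using d1 e(2)[OF that] has_derivative_bounded_linear by blast
    show ?thesis using * by (simp add: has_field_derivative_def scaleR mult.commute[of _ "D _ v"])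
  qed
  have zero: "D p v = 0"
    using DERIV_local_min[OF dz[of 0], of e] e by auto
  then show "D p v = 0" .
  have dd: "((\<lambda>t. D (p + t *\<^sub>R v) v) has_real_derivative D2 v) (at 0)"
  proof -
    have "((\<lambda>t. p + t *\<^sub>R v) has_derivative (\<lambda>h. h *\<^sub>R v)) (at 0)"
      by (auto intro!: derivative_eq_intros)
    from has_derivative_compose[OF this, of "\<lambda>x. D x v" D2] d2
    have *: "((\<lambda>t. D (p + t *\<^sub>R v) v) has_derivative (\<lambda>h. D2 (h *\<^sub>R v))) (at 0)" by simp
    interpret bounded_linear D2 using d2 has_derivative_bounded_linear by blast
    show ?thesis using * by (simp add: has_field_derivative_def scaleR mult.commute[of _ "D2 v"])
  qed
  show "0 \<le> D2 v"
  proof (rule ccontr)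
    assume "\<not> 0 \<le> D2 v"
    then obtain d where d: "d > 0" "\<And>h. 0 < h \<Longrightarrow> h < d \<Longrightarrow> D (p + h *\<^sub>R v) v < 0"
      using DERIV_neg_dec_right[OF dd] zero by auto
    define t where "t = min d e / 2"
    have t: "0 < t" "t < d" "t < e" using d(1) e(1) by (auto simp: t_def)
    obtain x where "0 < x" "x < t" "?z t - ?z 0 = t * D (p + x *\<^sub>R v) v"
      using MVT2[of 0 t ?z "\<lambda>t. D (p + t *\<^sub>R v) v"] dz t by auto
    then have "?z t < ?z 0"
      using d(2)[of x] t by (smt (verit) mult_pos_neg)
    then show False using e(2)[of t] t by auto
  qed
qed

section \<open>The Levi-Civita connection in coordinates\<close>

locale metric_patch =
  fixes S :: "'e::euclidean_space set" and G :: "'e \<Rightarrow> 'e \<Rightarrow> 'e \<Rightarrow> real"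
  assumes open_patch: "open S" and metric: "metric_on S G"
begin

lemma bilinear_G: "x \<in> S \<Longrightarrow> bilinear (G x)"
  and sym: "x \<in> S \<Longrightarrow> G x a b = G x b a"
  and pos: "x \<in> S \<Longrightarrow> a \<noteq> 0 \<Longrightarrow> 0 < G x a a"
  and smooth: "smooth_on S (\<lambda>x. G x a b)"
  using metric unfolding metric_on_def by blast+

lemmas G_simps = bilinear_ladd[OF bilinear_G] bilinear_radd[OF bilinear_G]
  bilinear_lsub[OF bilinear_G] bilinear_rsub[OF bilinear_G]
  bilinear_lmul[OF bilinear_G] bilinear_rmul[OF bilinear_G]
  bilinear_lneg[OF bilinear_G] bilinear_rneg[OF bilinear_G]
  bilinear_lzero[OF bilinear_G] bilinear_rzero[OF bilinear_G]

lemma nonneg: "x \<in> S \<Longrightarrow> 0 \<le> G x a a"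
  using pos[of x a] G_simps(9)[of x] by (cases "a = 0") auto

lemma nondegenerate:
  assumes "x \<in> S" "\<And>z. G x w z = G x w' z"
  shows "w = w'"
proof (rule ccontr)
  assume "w \<noteq> w'"
  then have "0 < G x (w - w') (w - w')" using pos assms(1) by simp
  then show False using assms by (simp add: G_simps)
qed

definition dG :: "'e \<Rightarrow> 'e \<Rightarrow> 'e \<Rightarrow> 'e \<Rightarrow> real" where
  "dG x h a b = frechet_derivative (\<lambda>y. G y a b) (at x) h"

lemma has_derivative_G: "x \<in> S \<Longrightarrow> ((\<lambda>y. G y a b) has_derivative (\<lambda>h. dG x h a b)) (at x)"
  unfolding dG_def using smooth_on_has_derivative[OF smooth] by simp

lemma differentiable_dG: "x \<in> S \<Longrightarrow> (\<lambda>y. dG y h a b) differentiable (at x)"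
  unfolding dG_def using smooth_on_differentiable[OF smooth_on_derivative[OF smooth]] .

lemma linear_dG: "x \<in> S \<Longrightarrow> linear (\<lambda>h. dG x h a b)"
  using has_derivative_G has_derivative_linear by blast

text \<open>The algebraic laws of \<open>G\<close> are known only on \<open>S\<close>; openness of
  \<open>S\<close> makes them hold near \<open>x\<close>, so they can be differentiated. The laws of
  \<open>dG\<close> in its last two arguments arise this way.\<close>

lemma dG_eqI:
  assumes "x \<in> S" "\<And>y. y \<in> S \<Longrightarrow> G y a b = f y" "(f has_derivative f') (at x)"
  shows "dG x h a b = f' h"
proof -
  have "((\<lambda>y. G y a b) has_derivative f') (at x)"
    by (rule has_derivative_transform_within_open[OF assms(3) open_patch assms(1)])
      (simp add: assms(2))
  then show ?thesis unfolding dG_def using frechet_derivative_at by metis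
qed

lemma dG_sym: "x \<in> S \<Longrightarrow> dG x h a b = dG x h b a"
  by (rule dG_eqI[OF _ _ has_derivative_G]) (auto intro: sym)

lemma dG_add: "x \<in> S \<Longrightarrow> dG x h a (b + c) = dG x h a b + dG x h a c"
  by (rule dG_eqI[OF _ _ has_derivative_add[OF has_derivative_G has_derivative_G]])
    (auto simp: G_simps)

lemma dG_scale: "x \<in> S \<Longrightarrow> dG x h a (r *\<^sub>R b) = r * dG x h a b"
  by (rule dG_eqI[OF _ _ has_derivative_mult_right[OF has_derivative_G]]) (auto simp: G_simps)

lemma dG_add_dir: "x \<in> S \<Longrightarrow> dG x (h + k) a b = dG x h a b + dG x k a b"
  and dG_scale_dir: "x \<in> S \<Longrightarrow> dG x (r *\<^sub>R h) a b = r * dG x h a b"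
  using linear_add[OF linear_dG] linear_cmul[OF linear_dG] by (metis, metis real_scaleR_def)

text \<open>The map \<open>N\<close> expresses \<open>G x\<close> through the Euclidean inner
  product. Nondegeneracy makes it injective, hence surjective by dimension, so the Euclidean
  representative of \<open>l\<close> has a preimage.\<close>

lemma Riesz:
  assumes x: "x \<in> S" and l: "linear l"
  shows "\<exists>w. \<forall>z. G x w z = l z"
proof -
  define N where "N w = (\<Sum>i\<in>Basis. G x w i *\<^sub>R i)" for w
  have N: "N w \<bullet> z = G x w z" for w z
  proof -
    have "N w \<bullet> z = (\<Sum>i\<in>Basis. (z \<bullet> i) * G x w i)"
      unfolding N_def by (simp add: inner_sum_left) (simp add: inner_commute mult.commute)
    also have "\<dots> = G x w (\<Sum>i\<in>Basis. (z \<bullet> i) *\<^sub>R i)"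
      using bilinear_G[OF x] linear_sum linear_cmul unfolding bilinear_def
      by (smt (verit, best) real_scaleR_def sum.cong)
    finally show ?thesis by (simp add: euclidean_representation)
  qed
  have "linear N"
    by (rule linearI; rule euclidean_eqI) (simp_all add: N G_simps[OF x] inner_add_left)
  moreover have "inj N"
    by (rule injI) (metis N nondegenerate[OF x])
  ultimately have "surj N" by (rule linear_injective_imp_surjective[OF _ _ refl])
  then obtain w where "N w = (\<Sum>i\<in>Basis. l i *\<^sub>R i)" by (metis surjD)
  then have "G x w z = (\<Sum>i\<in>Basis. l i *\<^sub>R i) \<bullet> z" for z using N by metis
  also have "\<dots>z = l z" for z
  proof -
    have "(\<Sum>i\<in>Basis. l i *\<^sub>R i) \<bullet> z = (\<Sum>i\<in>Basis. (z \<bullet> i) * l i)"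
      by (simp add: inner_sum_left) (simp add: inner_commute mult.commute)
    also have "\<dots> = l (\<Sum>i\<in>Basis. (z \<bullet> i) *\<^sub>R i)"
      using linear_sum[OF l] linear_cmul[OF l] by (simp add: linear_sum[OF l] linear_cmul[OF l])
    finally show ?thesis by (simp add: euclidean_representation)
  qed
  finally show ?thesis by blast
qed

section \<open>Christoffel symbols and the Koszul formula\<close>

abbreviation \<Gamma> where "\<Gamma> \<equiv> christoffel G"

text \<open>Justifies the definite description: half of the Koszul expression is linear in
  \<open>z\<close>, so \<open>Riesz\<close> supplies a representing vector, and nondegeneracy makes
  it unique.\<close>

lemma christoffel_eq:
  assumes x: "x \<in> S"
  shows "2 * G x (\<Gamma> x a b) z = dG x a b z + dG x b a z - dG x z a b"
proof -
  let ?l = "\<lambda>z. dG x a b z + dG x b a z - dG x z a b"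
  have "linear (\<lambda>z. ?l z / 2)"
    by (rule linearI) (simp_all add: dG_add[OF x] dG_scale[OF x] dG_add_dir[OF x] dG_scale_dir[OF x]
        field_simps)
  from Riesz[OF x this] obtain w where w: "\<And>z. G x w z = ?l z / 2" by blast
  have "\<Gamma> x a b = (THE w. \<forall>z. 2 * G x w z = ?l z)"
    unfolding christoffel_def dG_def ..
  also have "\<dots> = w"
    by (rule the_equality) (simp add: w, rule nondegenerate[OF x], simp add: w field_simps)
  finally show ?thesis by (simp add: w)
qed

lemma christoffel_eqI:
  assumes x: "x \<in> S" and "\<And>z. 2 * G x w z = dG x a b z + dG x b a z - dG x z a b"
  shows "\<Gamma> x a b = w"
  by (rule nondegenerate[OF x])
    (metis assms(2) christoffel_eq[OF x] mult_cancel_left zero_neq_numeral)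

lemma christoffel_sym:
  assumes x: "x \<in> S"
  shows "\<Gamma> x a b = \<Gamma> x b a"
  by (rule christoffel_eqI[OF x]) (simp add: christoffel_eq[OF x] dG_sym[OF x, of _ a b])

lemma linear_christoffel:
  assumes x: "x \<in> S"
  shows "linear (\<Gamma> x a)"
  by (rule linearI; rule christoffel_eqI[OF x])
    (simp_all add: G_simps[OF x] distrib_left christoffel_eq[OF x] dG_add[OF x] dG_scale[OF x]
      dG_add_dir[OF x] dG_scale_dir[OF x] dG_sym[OF x, of _ "_ + _"] dG_sym[OF x, of _ "_ *\<^sub>R _"]
      dG_sym[OF x, of _ b1 for b1] algebra_simps)

text \<open>Adding the Koszul formulas for \<open>(h, a)\<close> tested on \<open>b\<close> and for
  \<open>(h, b)\<close> tested on \<open>a\<close> cancels all derivatives except those in direction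
  \<open>h\<close>.\<close>

lemma metric_compatible:
  assumes x: "x \<in> S"
  shows "dG x h a b = G x (\<Gamma> x h a) b + G x a (\<Gamma> x h b)"
  using christoffel_eq[OF x, of h a b] christoffel_eq[OF x, of h b a] sym[OF x, of a "\<Gamma> x h b"]
    dG_sym[OF x, of h a b] by simp

section \<open>Differentiability of a field known through its inner products\<close>

lemma coercive_near:
  assumes p: "p \<in> S"
  defines "N \<equiv> \<lambda>x r. \<Sum>i\<in>Basis. G x r i *\<^sub>R i"
  shows "\<exists>c>0. \<forall>\<^sub>F x in nhds p. \<forall>r. c * norm r \<le> norm (N x r)"
proof -
  have lin: "linear (N x)" if "x \<in> S" for x
    unfolding N_def
    by (rule linearI) (simp_all add: G_simps[OF that] scaleR_left_distrib sum.distrib scaleR_sum_right)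
  have Ni: "N x r \<bullet> i = G x r i" if "i \<in> Basis" for x r i
    using that by (simp add: N_def)
  have "inj (N p)"
  proof (subst linear_injective_0[OF lin[OF p]], safe)
    fix r assume "N p r = 0"
    then have "G p r i = 0" if "i \<in> Basis" for i using Ni[OF that] by (metis inner_zero_left)
    moreover have "G p r r = (\<Sum>i\<in>Basis. (r \<bullet> i) * G p r i)"
    proof -
      have "G p r (\<Sum>i\<in>Basis. (r \<bullet> i) *\<^sub>R i) = (\<Sum>i\<in>Basis. (r \<bullet> i) * G p r i)"
        using bilinear_G[OF p] unfolding bilinear_def by (simp add: linear_sum linear_cmul)
      then show ?thesis by (simp add: euclidean_representation)
    qed
    ultimately show "r = 0" using pos[OF p, of r] by force
  qed
  then obtain c where c: "c > 0" "\<And>r. c * norm r \<le> norm (N p r)"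
    using linear_inj_bounded_below_pos[OF lin[OF p]] by blast
  \<comment> \<open>\<open>E x\<close> dominates the operator norm of \<open>N x - N p\<close> and
    is continuous at \<open>p\<close> with value \<open>0\<close>, so near \<open>p\<close> at most
    half of the lower bound \<open>c\<close> is lost.\<close>
  define E where "E x = (\<Sum>j\<in>Basis. norm (N x j - N p j))" for x
  have "isCont (\<lambda>x. G x a b) p" for a b
    using has_derivative_continuous[OF has_derivative_G[OF p]] .
  then have "isCont E p" unfolding E_def N_def by (intro continuous_intros) auto
  then have "E \<midarrow>p\<rightarrow> E p" by (simp add: isCont_def)
  moreover have "E p = 0" by (simp add: E_def)
  ultimately have "\<forall>\<^sub>F x in at p. E x < c / 2"
    using c order_tendstoD(2)[of E 0 "at p" "c / 2"] by simp
  then have "\<forall>\<^sub>F x in nhds p. E x < c / 2"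
    using \<open>E p = 0\<close> c by (auto simp: eventually_at_filter elim!: eventually_mono)
  moreover have "\<forall>\<^sub>F x in nhds p. x \<in> S"
    using open_patch p by (simp add: eventually_nhds_in_open)
  ultimately have "\<forall>\<^sub>F x in nhds p. \<forall>r. c / 2 * norm r \<le> norm (N x r)"
  proof eventually_elim
    case (elim x)
    show ?case
    proof
      fix r
      have rep: "N y r = (\<Sum>j\<in>Basis. (r \<bullet> j) *\<^sub>R N y j)" if "y \<in> S" for y
        using euclidean_representation[of r] linear_sum[OF lin[OF that]] linear_cmul[OF lin[OF that]]
        by (metis (no_types, lifting) sum.cong)
      have "norm (N x r - N p r) = norm (\<Sum>j\<in>Basis. (r \<bullet> j) *\<^sub>R (N x j - N p j))"
        using rep[OF elim(2)] rep[OF p] by (simp add: sum_subtractf scaleR_diff_right)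
      also have "\<dots> \<le> (\<Sum>j\<in>Basis. norm r * norm (N x j - N p j))"
        by (rule order.trans[OF norm_sum]) (auto intro!: sum_mono mult_right_mono Basis_le_norm)
      also have "\<dots> = norm r * E x" by (simp add: E_def sum_distrib_left)
      also have "\<dots> \<le> norm r * (c / 2)" using elim by (intro mult_left_mono) auto
      finally have "norm (N x r - N p r) \<le> c / 2 * norm r" by (simp add: mult.commute)
      with c(2)[of r] norm_triangle_ineq2[of "N p r" "N x r"] show "c / 2 * norm r \<le> norm (N x r)"
        by (simp add: norm_minus_commute)
    qed
  qed
  then show ?thesis using c(1) half_gt_zero by blast
qed

lemma G_expand: "x \<in> S \<Longrightarrow> G x w z = (\<Sum>j\<in>Basis. (w \<bullet> j) * G x j z)"
proof -
  assume x: "x \<in> S"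
  have "linear (\<lambda>w. G x w z)" by (rule linearI) (simp_all add: G_simps[OF x])
  from linear_sum[OF this, of "\<lambda>j. (w \<bullet> j) *\<^sub>R j" Basis] show ?thesis
    by (simp add: euclidean_representation G_simps[OF x])
qed

lemma dG_expand: "x \<in> S \<Longrightarrow> dG x h w z = (\<Sum>j\<in>Basis. (w \<bullet> j) * dG x h j z)"
proof -
  assume x: "x \<in> S"
  have "linear (\<lambda>w. dG x h z w)" by (rule linearI) (simp_all add: dG_add[OF x] dG_scale[OF x])
  from linear_sum[OF this, of "\<lambda>j. (w \<bullet> j) *\<^sub>R j" Basis] show ?thesis
    by (simp add: euclidean_representation dG_scale[OF x] dG_sym[OF x, of h _ z])
qed

text \<open>The product rule for a moving vector: expanding \<open>w x\<close> in the basis leaves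
  only inner products of constant fields, whose derivatives are \<open>dG\<close>.\<close>

lemma has_derivative_G_field:
  assumes p: "p \<in> S" and w: "(w has_derivative w') (at p)"
  shows "((\<lambda>x. G x (w x) z) has_derivative (\<lambda>h. dG p h (w p) z + G p (w' h) z)) (at p)"
proof (rule has_derivative_transform_within_open[OF _ open_patch p])
  show "((\<lambda>x. \<Sum>j\<in>Basis. (w x \<bullet> j) * G x j z) has_derivative
      (\<lambda>h. dG p h (w p) z + G p (w' h) z)) (at p)"
    by (rule derivative_eq_intros has_derivative_G[OF p] w refl)+
      (subst dG_expand[OF p], subst (2) G_expand[OF p], simp add: sum.distrib fun_eq_iff)
qed (rule G_expand[symmetric])

text \<open>The candidate derivative is read off from the product rule at \<open>p\<close> alone.
  The uniform lower bound on \<open>N x\<close> near \<open>p\<close> then turns a small error in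
  \<open>N x (w x)\<close> into a small error in \<open>w x\<close>, so no inverse of
  \<open>N x\<close> has to be differentiated.\<close>

lemma differentiable_field:
  assumes p: "p \<in> S" and d: "\<And>z. (\<lambda>x. G x (w x) z) differentiable (at p)"
  shows "w differentiable (at p)"
proof -
  define N where "N x r = (\<Sum>i\<in>Basis. G x r i *\<^sub>R i)" for x r
  have lin: "linear (N x)" if "x \<in> S" for x
    unfolding N_def
    by (rule linearI) (simp_all add: G_simps[OF that] scaleR_left_distrib sum.distrib scaleR_sum_right)
  obtain c where c: "c > 0" and N_lower: "\<forall>\<^sub>F x in nhds p. \<forall>r. c * norm r \<le> norm (N x r)"
    using coercive_near[OF p] unfolding N_def by blast
  have "inj (N p)"
  proof (subst linear_injective_0[OF lin[OF p]], safe)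
    fix r assume "N p r = 0"
    then have "c * norm r \<le> 0" using eventually_nhds_x_imp_x[OF N_lower] by (metis norm_zero)
    then show "r = 0" using c by (simp add: mult_le_0_iff)
  qed
  then have "surj (N p)" by (rule linear_injective_imp_surjective[OF lin[OF p] _ refl])
  from linear_surjective_right_inverse[OF lin[OF p] this]
  obtain Ni where Ni: "linear Ni" "N p \<circ> Ni = id" by blast
  have NNi: "N p (Ni r) = r" for r using Ni(2) by (metis comp_apply id_apply)
  have "(\<lambda>x. N x (w x)) differentiable (at p)"
    unfolding N_def by (auto intro!: differentiable_sum differentiable_scaleR d)
  then obtain l' where l': "((\<lambda>x. N x (w x)) has_derivative l') (at p)"
    unfolding differentiable_def by blast
  have dN: "((\<lambda>x. N x r) has_derivative (\<lambda>h. \<Sum>i\<in>Basis. dG p h r i *\<^sub>R i)) (at p)" for r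
    unfolding N_def by (auto intro!: derivative_eq_intros has_derivative_G p)
  \<comment> \<open>Solves the product rule for \<open>N x (w x)\<close> at \<open>p\<close>, whose
    derivative is \<open>l'\<close>, for the unknown derivative of \<open>w\<close>.\<close>
  define D where "D h = Ni (l' h - (\<Sum>i\<in>Basis. dG p h (w p) i *\<^sub>R i))" for h
  have linD: "linear D"
  proof -
    have "linear (\<lambda>h. l' h - (\<Sum>i\<in>Basis. dG p h (w p) i *\<^sub>R i))"
      using has_derivative_linear[OF l'] has_derivative_linear[OF dN] linear_compose_sub by blast
    from linear_compose[OF this Ni(1)] show ?thesis by (simp add: D_def[abs_def] o_def)
  qed
  then have bD: "bounded_linear D" by (simp add: linear_linear)
  have dD: "((\<lambda>x. D (x - p)) has_derivative D) (at p)"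
    by (rule bounded_linear.has_derivative[OF bD]) (auto intro!: derivative_eq_intros)
  \<comment> \<open>This is \<open>N x\<close> applied to the first-order error of \<open>w\<close>.
    Expanding \<open>D (x - p)\<close> in the basis makes every summand differentiable at
    \<open>p\<close> by known rules; the value and the derivative of \<open>R\<close> at
    \<open>p\<close> vanish.\<close>
  define R where "R x = N x (w x) - N x (w p) - (\<Sum>j\<in>Basis. (D (x - p) \<bullet> j) *\<^sub>R N x j)" for x
  have N_rep: "N x r = (\<Sum>j\<in>Basis. (r \<bullet> j) *\<^sub>R N x j)" if "x \<in> S" for x r
    using euclidean_representation[of r] linear_sum[OF lin[OF that]] linear_cmul[OF lin[OF that]]
    by (metis (no_types, lifting) sum.cong)
  have "(R has_derivative (\<lambda>h. l' h - (\<Sum>i\<in>Basis. dG p h (w p) i *\<^sub>R i) -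
      (\<Sum>j\<in>Basis. (D h \<bullet> j) *\<^sub>R N p j))) (at p)"
    unfolding R_def[abs_def]
    by (rule derivative_eq_intros l' dN dD refl)+ (simp add: linear_0[OF linD])
  moreover have "l' h - (\<Sum>i\<in>Basis. dG p h (w p) i *\<^sub>R i) - (\<Sum>j\<in>Basis. (D h \<bullet> j) *\<^sub>R N p j) = 0"
    for h
    using N_rep[OF p, of "D h"] NNi by (simp add: D_def)
  ultimately have dR: "(R has_derivative (\<lambda>h. 0)) (at p)" by simp
  have Rp: "R p = 0" by (simp add: R_def linear_0[OF linD])
  have R: "R x = N x (w x - w p - D (x - p))" if "x \<in> S" for x
    unfolding R_def N_rep[OF that, symmetric] by (simp add: linear_diff[OF lin[OF that]])
  have "(w has_derivative D) (at p)"
    unfolding has_derivative_at_alt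
  proof (intro conjI bD allI impI)
    fix e :: real assume e: "e > 0"
    have "\<forall>\<^sub>F x in nhds p. norm (R x) \<le> c * e * norm (x - p)"
      using dR e c unfolding has_derivative_at_alt eventually_nhds_metric Rp
      by (auto simp: dist_norm dest!: spec[of _ "c * e"])
    moreover have "\<forall>\<^sub>F x in nhds p. x \<in> S"
      using open_patch p by (simp add: eventually_nhds_in_open)
    ultimately have "\<forall>\<^sub>F x in nhds p. norm (w x - w p - D (x - p)) \<le> e * norm (x - p)"
      using N_lower
    proof eventually_elim
      case (elim x)
      then have "c * norm (w x - w p - D (x - p)) \<le> c * (e * norm (x - p))"
        using R[of x] by (smt (verit) mult.assoc)
      then show ?case using c by simp
    qed
    then show "\<exists>d>0. \<forall>y. norm (y - p) < d \<longrightarrow> norm (w y - w p - D (y - p)) \<le> e * norm (y - p)"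
      by (auto simp: eventually_nhds_metric dist_norm)
  qed
  then show ?thesis unfolding differentiable_def by blast
qed

lemma differentiable_christoffel:
  assumes p: "p \<in> S"
  shows "(\<lambda>x. \<Gamma> x a b) differentiable (at p)"
proof (rule differentiable_field[OF p])
  fix z
  have "(\<lambda>x. (dG x a b z + dG x b a z - dG x z a b) / 2) differentiable (at p)"
    by (intro derivative_intros differentiable_dG p) auto
  then obtain D where "((\<lambda>x. (dG x a b z + dG x b a z - dG x z a b) / 2) has_derivative D) (at p)"
    unfolding differentiable_def by blast
  then have "((\<lambda>x. G x (\<Gamma> x a b) z) has_derivative D) (at p)"
    by (rule has_derivative_transform_within_open[OF _ open_patch p])
      (simp add: christoffel_eq[symmetric])
  then show "(\<lambda>x. G x (\<Gamma> x a b) z) differentiable (at p)"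
    unfolding differentiable_def by blast
qed

text \<open>The derivative of \<open>\<Gamma> x a b\<close> is eliminated because the inner product
  of this vector with \<open>a\<close> is half of \<open>dG x b a a\<close>. The derivative of
  \<open>G x (\<Gamma> x b b) a\<close> is kept unexpanded, because for vertical \<open>b\<close>
  this function is known explicitly for the rescaled metric.\<close>

lemma curvature_inner:
  assumes p: "p \<in> S"
  shows "G p (curvature G p a b b) a =
    frechet_derivative (\<lambda>x. G x (\<Gamma> x b b) a) (at p) a - dG p a (\<Gamma> p b b) a
    + dG p (\<Gamma> p b b) a a / 2 - frechet_derivative (\<lambda>x. dG x b a a) (at p) b / 2
    + G p (\<Gamma> p a b) (\<Gamma> p a b)"
proof -
  let ?D = "\<lambda>a b. frechet_derivative (\<lambda>x. \<Gamma> x a b) (at p)"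
  have D: "((\<lambda>x. \<Gamma> x a b) has_derivative ?D a b) (at p)" for a b
    using differentiable_christoffel[OF p] frechet_derivative_works by blast
  have curv: "curvature G p a b b = ?D b b a + \<Gamma> p a (\<Gamma> p b b) - (?D a b b + \<Gamma> p b (\<Gamma> p a b))"
    unfolding curvature_def cov_deriv_def by simp
  have 1: "frechet_derivative (\<lambda>x. G x (\<Gamma> x b b) a) (at p) a = dG p a (\<Gamma> p b b) a + G p (?D b b a) a"
    using frechet_derivative_at[OF has_derivative_G_field[OF p D]] by metis
  \<comment> \<open>With \<open>a\<close> also as the test vector, the first and third terms of the
    Koszul formula cancel.\<close>
  have half: "G x (\<Gamma> x a b) a = dG x b a a / 2" if "x \<in> S" for x
    using christoffel_eq[OF that, of a b a] dG_sym[OF that, of a a b] by simp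
  have "((\<lambda>x. G x (\<Gamma> x a b) a) has_derivative
      (\<lambda>h. frechet_derivative (\<lambda>x. dG x b a a) (at p) h / 2)) (at p)"
    by (rule has_derivative_transform_within_open[OF _ open_patch p, of "\<lambda>x. dG x b a a / 2"])
      (use differentiable_dG[OF p] half in \<open>auto intro!: derivative_eq_intros simp: frechet_derivative_works\<close>)
  from has_derivative_unique[OF this has_derivative_G_field[OF p D]]
  have 2: "frechet_derivative (\<lambda>x. dG x b a a) (at p) b / 2 = dG p b (\<Gamma> p a b) a + G p (?D a b b) a"
    by metis
  have 3: "dG p b (\<Gamma> p a b) a = G p (\<Gamma> p b (\<Gamma> p a b)) a + G p (\<Gamma> p a b) (\<Gamma> p a b)"
    using metric_compatible[OF p, of b "\<Gamma> p a b" a] christoffel_sym[OF p, of a b] by simp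
  have 4: "G p (\<Gamma> p a (\<Gamma> p b b)) a = dG p (\<Gamma> p b b) a a / 2"
    using half[OF p] christoffel_eq[OF p, of a "\<Gamma> p b b" a] dG_sym[OF p, of a a] by simp
  show ?thesis unfolding curv by (simp add: G_simps[OF p] 1 2 3 4)
qed

lemma Cauchy_Schwarz:
  assumes x: "x \<in> S"
  shows "(G x a b)\<^sup>2 \<le> G x a a * G x b b"
proof (cases "b = 0")
  case False
  let ?t = "G x a b / G x b b"
  have b: "0 < G x b b" using pos[OF x False] .
  have "G x (a - ?t *\<^sub>R b) (a - ?t *\<^sub>R b) = G x a a - (G x a b)\<^sup>2 / G x b b"
    using b sym[OF x, of b a] by (simp add: G_simps[OF x] power2_eq_square)
  then have "(G x a b)\<^sup>2 / G x b b \<le> G x a a" using nonneg[OF x, of "a - ?t *\<^sub>R b"] by simp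
  then show ?thesis using b by (simp add: pos_divide_le_eq)
qed (simp add: G_simps[OF x])

text \<open>For each \<open>b\<close> the vector \<open>a b\<close> represents the functional
  \<open>b \<bullet> pr z\<close> of \<open>z\<close>, hence is orthogonal to the kernel of
  \<open>pr\<close>. Since \<open>b \<bullet> pr (a b)\<close> is the squared length of
  \<open>a b\<close>, the map \<open>pr \<circ> a\<close> is injective on \<open>'b\<close> and
  therefore onto.\<close>

lemma horizontal_lift:
  fixes pr :: "'e \<Rightarrow> 'b::euclidean_space"
  assumes x: "x \<in> S" and pr: "linear pr" "surj pr"
  shows "\<exists>X. pr X = pr z \<and> (\<forall>w. pr w = 0 \<longrightarrow> G x X w = 0)"
proof -
  have "\<exists>a. \<forall>b. \<forall>z. G x (a b) z = b \<bullet> pr z"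
  proof (intro choice allI)
    fix b show "\<exists>a. \<forall>z. G x a z = b \<bullet> pr z"
      by (rule Riesz[OF x])
        (rule linearI, simp_all add: linear_add[OF pr(1)] linear_cmul[OF pr(1)] inner_add_right)
  qed
  then obtain a where a: "\<And>b z. G x (a b) z = b \<bullet> pr z" by blast
  have "linear a"
    by (rule linearI; rule nondegenerate[OF x]) (simp_all add: a G_simps[OF x] inner_add_left)
  then have lin: "linear (pr \<circ> a)" using pr(1) linear_compose by blast
  have "inj (pr \<circ> a)"
  proof (subst linear_injective_0[OF lin], safe)
    fix b assume "(pr \<circ> a) b = 0"
    then have "G x (a b) (a b) = 0" by (simp add: a)
    then have "a b = 0" using pos[OF x] by force
    then have "b \<bullet> pr z = 0" for z using a[of b z] by (simp add: G_simps[OF x])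
    then show "b = 0" using pr(2) by (metis inner_eq_zero_iff surjD)
  qed
  then have "surj (pr \<circ> a)" using linear_injective_imp_surjective[OF lin _ refl] by blast
  then obtain b where "pr (a b) = pr z" by (metis comp_apply surjD)
  then show ?thesis using a by (metis inner_zero_right)
qed

end

section \<open>Curvature of a vertically rescaled metric\<close>

text \<open>The picture in one foliated chart: the kernel of \<open>pr\<close> consists of the leaf
  directions, \<open>\<sigma>\<close> stands for \<open>exp (2 * \<phi>)\<close>, and
  \<open>p\<close> is a minimum. The property \<open>horizontal_growth\<close> is all that is
  retained of the Riemannian submersion.\<close>

locale warped_patch = base: metric_patch S G\<^sub>0 + metric_patch S G
  for S :: "'e::euclidean_space set" and G\<^sub>0 G :: "'e \<Rightarrow> 'e \<Rightarrow> 'e \<Rightarrow> real" +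
  fixes pr :: "'e \<Rightarrow> 'b::euclidean_space" and \<sigma> :: "'e \<Rightarrow> real" and p :: 'e
  assumes linear_pr: "linear pr" and surj_pr: "surj pr" and p: "p \<in> S"
    and warp: "x \<in> S \<Longrightarrow> pr v = 0 \<Longrightarrow> G x v z = \<sigma> x * G\<^sub>0 x v z"
    and differentiable_\<sigma>: "x \<in> S \<Longrightarrow> \<sigma> differentiable (at x)"
    and twice_differentiable_\<sigma>: "(\<lambda>x. frechet_derivative \<sigma> (at x) h) differentiable (at p)"
    and \<sigma>_min: "x \<in> S \<Longrightarrow> \<sigma> p \<le> \<sigma> x"
    and \<sigma>_basic: "x \<in> S \<Longrightarrow> pr v = 0 \<Longrightarrow> frechet_derivative \<sigma> (at x) v = 0"
    and totally_geodesic: "x \<in> S \<Longrightarrow> pr v = 0 \<Longrightarrow> pr w = 0 \<Longrightarrow> pr (base.\<Gamma> x v w) = 0"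
    and horizontal_growth: "\<forall>u. pr u = 0 \<longrightarrow> G p a u = 0 \<Longrightarrow> pr v = 0 \<Longrightarrow>
      \<forall>\<^sub>F t in at 0. \<forall>u. pr u = 0 \<longrightarrow> (G (p + t *\<^sub>R v) a u)\<^sup>2 \<le>
        (G (p + t *\<^sub>R v) a a - G p a a) * G (p + t *\<^sub>R v) u u"
begin

abbreviation d\<sigma> where "d\<sigma> x \<equiv> frechet_derivative \<sigma> (at x)"

lemma has_derivative_\<sigma>: "x \<in> S \<Longrightarrow> (\<sigma> has_derivative d\<sigma> x) (at x)"
  using differentiable_\<sigma> frechet_derivative_works by blast

lemma has_derivative_d\<sigma>:
  "((\<lambda>x. d\<sigma> x h) has_derivative frechet_derivative (\<lambda>x. d\<sigma> x h) (at p)) (at p)"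
  using twice_differentiable_\<sigma> frechet_derivative_works by blast

lemma \<sigma>_critical: "d\<sigma> p h = 0"
  and \<sigma>_hessian: "0 \<le> frechet_derivative (\<lambda>x. d\<sigma> x h) (at p) h"
proof -
  have "\<forall>\<^sub>F t in at 0. \<sigma> p \<le> \<sigma> (p + t *\<^sub>R h)"
    using eventually_line_open[OF open_patch p] by eventually_elim (rule \<sigma>_min)
  from second_derivative_test[OF open_patch p has_derivative_\<sigma> has_derivative_d\<sigma> this]
  show "d\<sigma> p h = 0" "0 \<le> frechet_derivative (\<lambda>x. d\<sigma> x h) (at p) h" by auto
qed

lemma dG_warp:
  assumes x: "x \<in> S" and v: "pr v = 0"
  shows "dG x h v z = d\<sigma> x h * G\<^sub>0 x v z + \<sigma> x * base.dG x h v z"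
  by (rule trans[OF dG_eqI[OF x _ has_derivative_mult[OF has_derivative_\<sigma>[OF x] base.has_derivative_G[OF x]]]])
    (use v warp in auto)

text \<open>In the Koszul formulas of both metrics the derivatives of \<open>\<sigma>\<close> in the
  vertical directions \<open>v\<close> and \<open>w\<close> vanish, so only the one in direction
  \<open>z\<close> survives. Verticality of \<open>base.\<Gamma> x v w\<close> turns
  \<open>\<sigma>\<close> times \<open>G\<^sub>0\<close> into \<open>G\<close>.\<close>

lemma christoffel_warp:
  assumes x: "x \<in> S" and v: "pr v = 0" and w: "pr w = 0"
  shows "G x (\<Gamma> x v w) z = G x (base.\<Gamma> x v w) z - d\<sigma> x z * G\<^sub>0 x v w / 2"
proof -
  have "2 * G x (\<Gamma> x v w) z = \<sigma> x * (2 * G\<^sub>0 x (base.\<Gamma> x v w) z) - d\<sigma> x z * G\<^sub>0 x v w"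
    unfolding christoffel_eq[OF x] base.christoffel_eq[OF x]
    using \<sigma>_basic[OF x v] \<sigma>_basic[OF x w]
    by (simp add: dG_warp[OF x v] dG_warp[OF x w] algebra_simps)
  then show ?thesis using warp[OF x totally_geodesic[OF x v w], of z] by simp
qed

lemma christoffel_warp_p:
  assumes "pr v = 0" "pr w = 0"
  shows "\<Gamma> p v w = base.\<Gamma> p v w"
  by (rule nondegenerate[OF p]) (simp add: christoffel_warp[OF p assms] \<sigma>_critical)

lemma vertical_christoffel: "pr v = 0 \<Longrightarrow> pr w = 0 \<Longrightarrow> pr (\<Gamma> p v w) = 0"
  using christoffel_warp_p totally_geodesic[OF p] by simp

section \<open>Second-order behaviour of a horizontal vector at the minimum\<close>

context
  fixes a
  assumes horizontal: "\<forall>u. pr u = 0 \<longrightarrow> G p a u = 0"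
begin

lemma orthogonal_vertical: "pr u = 0 \<Longrightarrow> G p a u = 0"
  using horizontal by blast

text \<open>Choosing \<open>u = v\<close> in \<open>horizontal_growth\<close> puts a square on the
  left and a positive factor on the right, so the other factor is nonnegative.\<close>

lemma growth_nonneg:
  assumes v: "pr v = 0"
  shows "\<forall>\<^sub>F t in at 0. G p a a \<le> G (p + t *\<^sub>R v) a a"
proof (cases "v = 0")
  case False
  show ?thesis using horizontal_growth[OF horizontal v] eventually_line_open[OF open_patch p, of v]
  proof eventually_elim
    case (elim t)
    then have "0 \<le> (G (p + t *\<^sub>R v) a a - G p a a) * G (p + t *\<^sub>R v) v v"
      using v by (meson order_trans zero_le_power2)
    then show ?case using pos[OF elim(2) False] by (simp add: zero_le_mult_iff)
  qed
qed auto

lemma has_derivative_dG: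
  "((\<lambda>x. dG x h b c) has_derivative frechet_derivative (\<lambda>x. dG x h b c) (at p)) (at p)"
  using differentiable_dG[OF p] frechet_derivative_works by blast

lemma dG_horizontal: "pr v = 0 \<Longrightarrow> dG p v a a = 0"
  and hessian_nonneg: "pr v = 0 \<Longrightarrow> 0 \<le> frechet_derivative (\<lambda>x. dG x v a a) (at p) v"
  using second_derivative_test[OF open_patch p has_derivative_G has_derivative_dG growth_nonneg]
  by auto

text \<open>\<open>hessian_nonneg\<close> alone would not absorb the squared length of
  \<open>\<Gamma> p a v\<close> in the curvature. When \<open>\<Gamma> p a v\<close> is vertical it
  may serve as \<open>u\<close> in \<open>horizontal_growth\<close>; the difference
  \<open>?\<psi>\<close> of the two sides vanishes at \<open>p\<close> and is nonnegative along the
  line, so its second derivative is nonnegative.\<close>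

lemma hessian_lower:
  assumes v: "pr v = 0" and u: "pr (\<Gamma> p a v) = 0"
  shows "2 * G p (\<Gamma> p a v) (\<Gamma> p a v) \<le> frechet_derivative (\<lambda>x. dG x v a a) (at p) v"
proof (cases "\<Gamma> p a v = 0")
  case True
  then show ?thesis using hessian_nonneg[OF v] by (simp add: G_simps[OF p])
next
  case False
  define u where "u = \<Gamma> p a v"
  define \<kappa> where "\<kappa> = G p u u"
  have \<kappa>: "\<kappa> > 0" using pos[OF p] False by (simp add: \<kappa>_def u_def)
  have u': "pr u = 0" using u u_def by simp
  \<comment> \<open>In the compatibility formula the term \<open>G p a (\<Gamma> p v u)\<close>
    drops out, because \<open>\<Gamma> p v u\<close> is vertical and \<open>a\<close> is horizontal
    at \<open>p\<close>.\<close>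
  have dGu: "dG p v a u = \<kappa>"
    using metric_compatible[OF p, of v a u] christoffel_sym[OF p, of v a]
      orthogonal_vertical[OF vertical_christoffel[OF v u']] by (simp add: u_def \<kappa>_def)
  let ?\<psi> = "\<lambda>x. (G x a a - G p a a) * G x u u - (G x a u)\<^sup>2"
  let ?D = "\<lambda>x h. dG x h a a * G x u u + (G x a a - G p a a) * dG x h u u - 2 * (G x a u * dG x h a u)"
  let ?H = "\<lambda>a u. frechet_derivative (\<lambda>x. dG x v a u) (at p)"
  let ?D2 = "\<lambda>h. ?H a a h * G p u u + dG p v a a * dG p h u u
    + (dG p h a a * dG p v u u + (G p a a - G p a a) * ?H u u h)
    - 2 * (dG p h a u * dG p v a u + G p a u * ?H a u h)"
  have "0 \<le> ?D2 v"
  proof (rule second_derivative_test(2)[OF open_patch p, of ?\<psi> ?D v ?D2])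
    show "(?\<psi> has_derivative ?D x) (at x)" if "x \<in> S" for x
      by (rule derivative_eq_intros has_derivative_G[OF that] refl)+
        (simp add: fun_eq_iff algebra_simps)
    show "((\<lambda>x. ?D x v) has_derivative ?D2) (at p)"
      by (rule derivative_eq_intros has_derivative_G[OF p] has_derivative_dG refl)+
        (simp add: fun_eq_iff algebra_simps)
    show "\<forall>\<^sub>F t in at 0. ?\<psi> p \<le> ?\<psi> (p + t *\<^sub>R v)"
      using horizontal_growth[OF horizontal v] by eventually_elim (use u' orthogonal_vertical[OF u'] in auto)
  qed
  \<comment> \<open>Everything with a factor \<open>dG p v a a\<close>, \<open>G p a u\<close> or
    \<open>G p a a - G p a a\<close> vanishes; the rest is the first term and the square of
    \<open>dG p v a u\<close>.\<close>
  also have "?D2 v = \<kappa> * (?H a a v - 2 * \<kappa>)"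
    using dGu orthogonal_vertical[OF u'] dG_horizontal[OF v] by (simp add: \<kappa>_def algebra_simps)
  finally show ?thesis using \<kappa> by (simp add: zero_le_mult_iff \<kappa>_def u_def)
qed

text \<open>In \<open>curvature_inner\<close>, the warped formula for
  \<open>G x (\<Gamma> x v v) a\<close> contributes minus half the Hessian of
  \<open>\<sigma>\<close> times \<open>G\<^sub>0 p v v\<close>; the derivative of
  \<open>G x a a\<close> along the vertical vector \<open>\<Gamma> p v v\<close> is zero; and
  \<open>hessian_lower\<close> balances the remaining second derivative against the squared length
  of \<open>\<Gamma> p a v\<close>.\<close>

lemma curvature_nonpos:
  assumes v: "pr v = 0" and u: "pr (\<Gamma> p a v) = 0"
  shows "G p (curvature G p a v v) a \<le> 0"
proof -
  let ?W = "\<lambda>x. base.\<Gamma> x v v"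
  let ?W' = "frechet_derivative ?W (at p)"
  let ?\<sigma>2 = "frechet_derivative (\<lambda>x. d\<sigma> x a) (at p)"
  have W: "(?W has_derivative ?W') (at p)"
    using base.differentiable_christoffel[OF p] frechet_derivative_works by blast
  \<comment> \<open>The field \<open>?W\<close> stays in the kernel of \<open>pr\<close> on all of
    \<open>S\<close>, so its derivative does too, even in the horizontal direction
    \<open>a\<close>.\<close>
  have "pr (?W' a) = 0"
  proof -
    have bl: "bounded_linear pr" using linear_pr by (simp add: linear_linear)
    have "((\<lambda>x. pr (?W x)) has_derivative (\<lambda>h. pr (?W' h))) (at p)"
      by (rule bounded_linear.has_derivative[OF bl W])
    moreover have "((\<lambda>x. pr (?W x)) has_derivative (\<lambda>h. 0)) (at p)"
      by (rule has_derivative_transform_within_open[OF has_derivative_const[of 0] open_patch p])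
        (simp add: totally_geodesic v)
    ultimately show ?thesis using has_derivative_unique by metis
  qed
  then have W'a: "G p (?W' a) a = 0" using orthogonal_vertical sym[OF p] by metis
  note has_derivative_diff[OF has_derivative_G_field[OF p W, of a] has_derivative_mult_right[OF
        has_derivative_mult[OF has_derivative_d\<sigma>[of a] base.has_derivative_G[OF p, of v v]], of "1 / 2"]]
  then have "((\<lambda>x. G x (\<Gamma> x v v) a) has_derivative (\<lambda>h. dG p h (?W p) a + G p (?W' h) a
      - 1 / 2 * (d\<sigma> p a * base.dG p h v v + ?\<sigma>2 h * G\<^sub>0 p v v))) (at p)"
    by (rule has_derivative_transform_within_open[OF _ open_patch p])
      (simp add: christoffel_warp v)
  from frechet_derivative_at[OF this]
  have "frechet_derivative (\<lambda>x. G x (\<Gamma> x v v) a) (at p) a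
      = dG p a (\<Gamma> p v v) a - ?\<sigma>2 a * G\<^sub>0 p v v / 2"
    using W'a \<sigma>_critical[of a] christoffel_warp_p[OF v v] by (auto dest!: fun_cong[where x = a])
  moreover have "dG p (\<Gamma> p v v) a a = 0"
    using dG_horizontal vertical_christoffel v by blast
  moreover have "0 \<le> ?\<sigma>2 a * G\<^sub>0 p v v"
    using \<sigma>_hessian base.nonneg[OF p] by simp
  ultimately show ?thesis
    unfolding curvature_inner[OF p] using hessian_lower[OF v u] by simp
qed

text \<open>A dimension count for \<open>\<Lambda>\<close>, whose target has dimension
  \<open>2 * DIM('b)\<close>. A trivial kernel would make it bijective under the assumption on
  dimensions, and one value that it cannot take excludes this. The missing value is what settles the
  borderline \<open>DIM('e) = 2 * DIM('b)\<close>.\<close>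

lemma ex_vertical_christoffel:
  assumes "2 * DIM('b) \<le> DIM('e)" and "a \<noteq> 0"
  shows "\<exists>v. v \<noteq> 0 \<and> pr v = 0 \<and> pr (\<Gamma> p a v) = 0"
proof (rule ccontr)
  assume neg: "\<not> ?thesis"
  define \<Lambda> where "\<Lambda> v = (pr v, pr (\<Gamma> p a v))" for v
  have lin: "linear \<Lambda>"
    unfolding \<Lambda>_def
    by (rule linearI) (simp_all add: linear_add[OF linear_pr] linear_cmul[OF linear_pr]
        linear_add[OF linear_christoffel[OF p]] linear_cmul[OF linear_christoffel[OF p]])
  have inj: "inj \<Lambda>"
    unfolding linear_injective_0[OF lin] using neg by (auto simp: \<Lambda>_def zero_prod_def)
  have "dim (UNIV :: ('b \<times> 'b) set) = dim (UNIV :: 'e set)"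
    using dim_image_eq[OF lin, of UNIV] inj assms(1) dim_subset_UNIV[of "range \<Lambda>"] by simp
  from linear_injective_imp_surjective[OF lin inj this]
  \<comment> \<open>This value makes \<open>\<Gamma> p a v\<close> equal to \<open>a\<close> up to a
    vertical vector, so its inner product with \<open>a\<close> would be \<open>G p a a > 0\<close>;
    yet that inner product is half of \<open>dG p v a a\<close>, which is zero.\<close>
  obtain v where "\<Lambda> v = (0, pr a)" by (metis surjD)
  then have v: "pr v = 0" and eq: "pr (\<Gamma> p a v - a) = 0"
    by (auto simp: \<Lambda>_def linear_diff[OF linear_pr])
  have "G p (\<Gamma> p a v) a = dG p v a a / 2"
    using christoffel_eq[OF p, of a v a] dG_sym[OF p, of a a v] by simp
  moreover have "G p (\<Gamma> p a v - a) a = 0" using orthogonal_vertical[OF eq] sym[OF p] by metis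
  ultimately show False
    using dG_horizontal[OF v] pos[OF p assms(2)] by (simp add: G_simps[OF p])
qed

end

lemma dimension_bound:
  assumes "\<And>a b. a \<noteq> b \<Longrightarrow> independent {a, b} \<Longrightarrow> 0 < sectional_curvature G p a b"
  shows "DIM('e) < 2 * DIM('b)"
proof (rule ccontr)
  assume "\<not> ?thesis"
  then have dim: "2 * DIM('b) \<le> DIM('e)" by simp
  \<comment> \<open>The codimension is positive, so a basis vector \<open>b\<close> exists; the
    vector representing \<open>b \<bullet> pr z\<close> is then horizontal and nonzero.\<close>
  obtain b :: 'b where b: "b \<in> Basis" using nonempty_Basis by blast
  have "linear (\<lambda>z. b \<bullet> pr z)"
    by (rule linearI) (simp_all add: linear_add[OF linear_pr] linear_cmul[OF linear_pr] inner_add_right)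
  from Riesz[OF p this] obtain a where a: "\<And>z. G p a z = b \<bullet> pr z" by blast
  have hor: "\<forall>u. pr u = 0 \<longrightarrow> G p a u = 0" using a by simp
  obtain y where "pr y = b" using surj_pr by (metis surjD)
  then have "G p a y = 1" using a b by simp
  then have "a \<noteq> 0" using G_simps(9)[OF p] by auto
  from ex_vertical_christoffel[OF hor dim this]
  obtain v where v: "v \<noteq> 0" "pr v = 0" "pr (\<Gamma> p a v) = 0" by blast
  have orth: "G p a v = 0" using hor v by blast
  have paa: "0 < G p a a" and pvv: "0 < G p v v" using pos[OF p] v \<open>a \<noteq> 0\<close> by auto
  have "a \<notin> span {v}"
    using orth paa by (auto simp: span_singleton G_simps[OF p])
  then have "independent {a, v}" using v by (simp add: independent_insert)
  moreover have "a \<noteq> v" using orth pvv by auto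
  ultimately have "0 < sectional_curvature G p a v" using assms by blast
  moreover have "sectional_curvature G p a v \<le> 0"
    unfolding sectional_curvature_def using curvature_nonpos[OF hor v(2,3)] orth paa pvv
    by (simp add: divide_nonpos_pos)
  ultimately show False by simp
qed

end

section \<open>Charts and foliations\<close>

lemma frechet_derivative_line_constant:
  fixes f :: "'a::real_normed_vector \<Rightarrow> 'b::real_normed_vector"
  assumes f: "f differentiable (at x)"
    and const: "\<forall>\<^sub>F t in at 0. f (x + t *\<^sub>R v) = f x"
  shows "frechet_derivative f (at x) v = 0"
proof -
  let ?D = "frechet_derivative f (at x)"
  have D: "(f has_derivative ?D) (at x)" using f frechet_derivative_works by blast
  have "((\<lambda>t. x + t *\<^sub>R v) has_derivative (\<lambda>h. h *\<^sub>R v)) (at 0)"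
    by (auto intro!: derivative_eq_intros)
  from has_derivative_compose[OF this, of f ?D] D
  have "((\<lambda>t. f (x + t *\<^sub>R v)) has_derivative (\<lambda>h. ?D (h *\<^sub>R v))) (at 0)" by simp
  then have "((\<lambda>t::real. f x) has_derivative (\<lambda>h. ?D (h *\<^sub>R v))) (at 0)"
    by (rule has_derivative_transform_eventually) (use const in auto)
  from has_derivative_unique[OF this has_derivative_const]
  show ?thesis by (metis scaleR_one)
qed

lemma smooth_on_const: "smooth_on S (\<lambda>_. c)"
proof -
  have "Ck_on k (\<lambda>_. c) S" for k and c :: 'b and S :: "'a set"
    by (induction k arbitrary: c) (auto simp: frechet_derivative_eqI[OF has_derivative_const])
  then show ?thesis by (simp add: smooth_on_def)
qed

section \<open>Charts, tangent vectors and smooth functions\<close>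

locale smooth_atlas =
  fixes M :: "'m topology" and A :: "('m, 'e::euclidean_space) chart set"
  assumes manifold: "smooth_manifold M A"
begin

lemma chart: "c \<in> A \<Longrightarrow> is_chart M c"
  and compatible_charts: "c \<in> A \<Longrightarrow> d \<in> A \<Longrightarrow> compatible c d"
  and covering: "(\<Union>c\<in>A. dom_of c) = topspace M"
  using manifold unfolding smooth_manifold_def by blast+

lemma openin_dom: "c \<in> A \<Longrightarrow> openin M (dom_of c)"
  and open_coords: "c \<in> A \<Longrightarrow> open (coords c ` dom_of c)"
  and homeomorphic_coords: "c \<in> A \<Longrightarrow>
    homeomorphic_map (subtopology M (dom_of c)) (top_of_set (coords c ` dom_of c)) (coords c)"
  using chart unfolding is_chart_def by blast+

lemma topspace_dom: "c \<in> A \<Longrightarrow> topspace (subtopology M (dom_of c)) = dom_of c"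
  using openin_subset[OF openin_dom, of c] by (simp add: inf.absorb2)

lemma inj_coords: "c \<in> A \<Longrightarrow> inj_on (coords c) (dom_of c)"
  using homeomorphic_imp_injective_map[OF homeomorphic_coords] topspace_dom by metis

lemma chart_inv_coords [simp]: "c \<in> A \<Longrightarrow> q \<in> dom_of c \<Longrightarrow> chart_inv c (coords c q) = q"
  unfolding chart_inv_def by (simp add: inj_coords)

lemma chart_inv_in: "x \<in> coords c ` dom_of c \<Longrightarrow> chart_inv c x \<in> dom_of c"
  and coords_chart_inv: "x \<in> coords c ` dom_of c \<Longrightarrow> coords c (chart_inv c x) = x"
  unfolding chart_inv_def by (auto intro: inv_into_into f_inv_into_f)

lemma continuous_chart_inv:
  assumes c: "c \<in> A"
  shows "continuous_map (top_of_set (coords c ` dom_of c)) M (chart_inv c)"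
proof -
  obtain g where g: "homeomorphic_maps (subtopology M (dom_of c))
      (top_of_set (coords c ` dom_of c)) (coords c) g"
    using homeomorphic_coords[OF c] homeomorphic_map_maps by blast
  then have "continuous_map (top_of_set (coords c ` dom_of c)) (subtopology M (dom_of c)) g"
    by (simp add: homeomorphic_maps_def)
  moreover have "g x = chart_inv c x" if "x \<in> coords c ` dom_of c" for x
    using g that c topspace_dom[OF c] unfolding homeomorphic_maps_def by auto
  ultimately show ?thesis
    by (metis (no_types, lifting) continuous_map_eq continuous_map_into_fulltopology
        topspace_euclidean_subtopology)
qed

lemma open_coords_image:
  assumes c: "c \<in> A" and U: "openin M U"
  shows "open (coords c ` (U \<inter> dom_of c))"
proof -
  have "openin (subtopology M (dom_of c)) (U \<inter> dom_of c)"
    using U by (simp add: openin_subtopology_Int)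
  then have "openin (top_of_set (coords c ` dom_of c)) (coords c ` (U \<inter> dom_of c))"
    using homeomorphic_imp_open_map[OF homeomorphic_coords[OF c]] unfolding open_map_def by blast
  then show ?thesis using open_coords[OF c] openin_open_trans by blast
qed

lemma transition_coords: "c \<in> A \<Longrightarrow> q \<in> dom_of c \<Longrightarrow> transition c d (coords c q) = coords d q"
  by (simp add: transition_def)

lemma has_derivative_transition:
  assumes "c \<in> charts_at A q" "d \<in> charts_at A q"
  shows "(transition c d has_derivative frechet_derivative (transition c d) (at (coords c q)))
    (at (coords c q))"
  using assms compatible_charts[of c d] unfolding compatible_def charts_at_def
  by (auto intro: smooth_on_has_derivative)

text \<open>The chain rule; the underlying identity of maps holds on the triple overlap, whose image
  under \<open>coords c\<close> is open.\<close>

lemma transition_cocycle: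
  assumes c: "c \<in> charts_at A q" and d: "d \<in> charts_at A q" and e: "e \<in> charts_at A q"
  shows "frechet_derivative (transition c e) (at (coords c q)) a =
    frechet_derivative (transition d e) (at (coords d q))
      (frechet_derivative (transition c d) (at (coords c q)) a)"
proof -
  have cA: "c \<in> A" "d \<in> A" "e \<in> A" and q: "q \<in> dom_of c" "q \<in> dom_of d" "q \<in> dom_of e"
    using assms by (auto simp: charts_at_def)
  let ?U = "dom_of d \<inter> dom_of e"
  have "(transition d e has_derivative frechet_derivative (transition d e) (at (coords d q)))
      (at (transition c d (coords c q)))"
    using has_derivative_transition[OF d e] transition_coords[OF cA(1) q(1)] by simp
  from has_derivative_compose[OF has_derivative_transition[OF c d] this]
  have "((\<lambda>x. transition d e (transition c d x)) has_derivative
    (\<lambda>a. frechet_derivative (transition d e) (at (coords d q))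
      (frechet_derivative (transition c d) (at (coords c q)) a))) (at (coords c q))" .
  then have "(transition c e has_derivative
    (\<lambda>a. frechet_derivative (transition d e) (at (coords d q))
      (frechet_derivative (transition c d) (at (coords c q)) a))) (at (coords c q))"
  proof (rule has_derivative_transform_within_open)
    show "open (coords c ` (?U \<inter> dom_of c))"
      using open_coords_image[OF cA(1)] openin_dom cA by blast
  qed (use q cA in \<open>auto simp: transition_coords\<close>)
  then show ?thesis by (simp add: frechet_derivative_eqI)
qed

lemma coord_vector_self [simp]:
  assumes c: "c \<in> charts_at A q"
  shows "coord_vector A c q a c = a"
proof -
  have cA: "c \<in> A" "q \<in> dom_of c" using c by (auto simp: charts_at_def)
  have "(transition c c has_derivative (\<lambda>h. h)) (at (coords c q))"
    by (rule has_derivative_transform_within_open[OF has_derivative_ident open_coords[OF cA(1)]])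
      (use cA in \<open>auto simp: transition_coords\<close>)
  then show ?thesis using c by (simp add: coord_vector_def frechet_derivative_eqI)
qed

lemma coord_vector_add:
  assumes c: "c \<in> charts_at A q"
  shows "coord_vector A c q (a + b) = coord_vector A c q a +\<^sub>T coord_vector A c q b"
  using linear_add[OF has_derivative_linear[OF has_derivative_transition[OF c]]]
  by (auto simp: coord_vector_def tangent_add_def)

lemma coord_vector_tangent:
  assumes c: "c \<in> charts_at A q"
  shows "coord_vector A c q a \<in> tangent_space A q"
  unfolding tangent_space_def mem_Collect_eq coord_vector_def
proof (intro conjI ballI allI impI)
  fix d e assume de: "d \<in> charts_at A q" "e \<in> charts_at A q"
  show "(if e \<in> charts_at A q then frechet_derivative (transition c e) (at (coords c q)) a else 0) =
    frechet_derivative (transition d e) (at (coords d q))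
      (if d \<in> charts_at A q then frechet_derivative (transition c d) (at (coords c q)) a else 0)"
    unfolding if_P[OF de(1)] if_P[OF de(2)] by (rule transition_cocycle[OF c de])
qed (rule if_not_P)

lemma tangent_coord_vector:
  assumes "c \<in> charts_at A q" "v \<in> tangent_space A q"
  shows "v = coord_vector A c q (v c)"
proof
  fix d show "v d = coord_vector A c q (v c) d"
    using assms unfolding tangent_space_def coord_vector_def mem_Collect_eq
    by (metis (no_types, lifting))
qed

text \<open>Smoothness gives continuity chart by chart, and the pasting lemma glues over the open
  cover by chart domains.\<close>

lemma continuous_smooth_function:
  assumes f: "smooth_map_on A (topspace M) f"
  shows "continuous_map M euclidean f"
proof (rule pasting_lemma[where I = A and T = dom_of and f = "\<lambda>_. f"])
  fix c assume c: "c \<in> A"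
  show "openin M (dom_of c)" by (rule openin_dom[OF c])
  have dom: "topspace M \<inter> dom_of c = dom_of c"
    using openin_subset[OF openin_dom[OF c]] by blast
  then have "smooth_on (coords c ` dom_of c) (f \<circ> chart_inv c)"
    using f c unfolding smooth_map_on_def by metis
  then have "continuous_on (coords c ` dom_of c) (f \<circ> chart_inv c)"
    unfolding smooth_on_def using Ck_on.simps(1) by blast
  then have "continuous_map (subtopology M (dom_of c)) euclidean ((f \<circ> chart_inv c) \<circ> coords c)"
    using homeomorphic_imp_continuous_map[OF homeomorphic_coords[OF c]]
    by (metis continuous_map_compose continuous_map_iff_continuous)
  then show "continuous_map (subtopology M (dom_of c)) euclidean f"
    by (rule continuous_map_eq) (use c topspace_dom in auto)
next
  fix x assume "x \<in> topspace M"
  then show "\<exists>j. j \<in> A \<and> x \<in> dom_of j \<and> f x = f x" using covering by blast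
qed (rule refl)

lemma smooth_function_attains_inf:
  fixes f :: "'m \<Rightarrow> real"
  assumes "smooth_map_on A (topspace M) f" "compact_space M" "topspace M \<noteq> {}"
  obtains p where "p \<in> topspace M" "\<And>q. q \<in> topspace M \<Longrightarrow> f p \<le> f q"
proof -
  have "compact (f ` topspace M)"
    using image_compactin[OF _ continuous_smooth_function[OF assms(1)]] assms(2)
    by (simp add: compact_space_def)
  then obtain y where "y \<in> f ` topspace M" "\<And>z. z \<in> f ` topspace M \<Longrightarrow> y \<le> z"
    using compact_attains_inf[of "f ` topspace M"] assms(3) by blast
  then show thesis using that by auto
qed

end

section \<open>Foliated charts, plaques and vertical vectors\<close>

locale foliated_manifold = smooth_atlas M A
  for M :: "'m topology" and A :: "('m, 'e::euclidean_space) chart set" +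
  fixes pr :: "'e \<Rightarrow> 'b::euclidean_space" and F :: "'m set set"
  assumes foliation: "foliation M A pr F"
begin

lemma linear_pr: "linear pr" and surj_pr: "surj pr"
  and partition: "partition_on (topspace M) F"
  using foliation unfolding foliation_def by blast+

lemma foliated_chart_in_atlas: "foliated_chart M A pr F c \<Longrightarrow> c \<in> A"
  by (simp add: foliated_chart_def)

text \<open>The level set of \<open>pr\<close> through \<open>q\<close> is a connected component of
  the part of \<open>L\<close> in the chart domain, so it cannot leave \<open>L\<close>.\<close>

lemma foliated_chart_plaque:
  assumes c: "foliated_chart M A pr F c" and L: "L \<in> F" "q \<in> L"
    and q: "q \<in> dom_of c" and r: "r \<in> dom_of c" and pr: "pr (coords c q) = pr (coords c r)"
  shows "r \<in> L"
proof -
  have "connected_component_of_set (subtopology M (dom_of c \<inter> L)) q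
      = {r \<in> dom_of c. (pr \<circ> coords c) r = (pr \<circ> coords c) q}"
    using c L q unfolding foliated_chart_def fibres_are_plaques_def by blast
  then have "r \<in> connected_component_of_set (subtopology M (dom_of c \<inter> L)) q"
    using r pr by simp
  moreover have "connected_component_of_set (subtopology M (dom_of c \<inter> L)) q
      \<subseteq> topspace (subtopology M (dom_of c \<inter> L))"
    by (rule connected_component_of_subset_topspace)
  ultimately show ?thesis unfolding topspace_subtopology by blast
qed

text \<open>Compares two descriptions of plaques, by the chart \<open>c\<close> and by the map
  \<open>f\<close> on \<open>U\<close>. As \<open>T\<close> lies on one level of \<open>pr\<close>,
  its image lies in one leaf \<open>L\<close>; being connected and inside \<open>U\<close>, it lies
  in one component of \<open>U \<inter> L\<close>, which is a fibre of \<open>f\<close>.\<close>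

lemma constant_on_plaque:
  assumes c: "foliated_chart M A pr F c" and f: "fibres_are_plaques M F U f"
    and T: "connected T" "T \<subseteq> coords c ` (U \<inter> dom_of c)"
    and pr: "\<forall>z\<in>T. pr z = pr x" and x: "x \<in> T" and y: "y \<in> T"
  shows "f (chart_inv c y) = f (chart_inv c x)"
proof -
  have cA: "c \<in> A" by (rule foliated_chart_in_atlas[OF c])
  have inv: "chart_inv c z \<in> U \<inter> dom_of c" if "z \<in> T" for z
    using T(2) that cA by auto
  have co: "coords c (chart_inv c z) = z" if "z \<in> T" for z
    using T(2) that by (intro coords_chart_inv) auto
  have "chart_inv c x \<in> topspace M" using inv[OF x] openin_subset[OF openin_dom[OF cA]] by blast
  then obtain L where L: "L \<in> F" "chart_inv c x \<in> L"
    using partition by (auto simp: partition_on_def)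
  have sub: "chart_inv c ` T \<subseteq> U \<inter> L"
  proof (rule image_subsetI)
    fix z assume z: "z \<in> T"
    have "chart_inv c z \<in> L"
      by (rule foliated_chart_plaque[OF c L]) (use inv[OF z] inv[OF x] co[OF z] co[OF x] bspec[OF pr z] in auto)
    then show "chart_inv c z \<in> U \<inter> L" using inv[OF z] by blast
  qed
  have "connectedin (top_of_set (coords c ` dom_of c)) T"
    using T by (auto simp: connectedin_subtopology)
  then have "connectedin M (chart_inv c ` T)"
    by (rule connectedin_continuous_map_image[OF continuous_chart_inv[OF cA]])
  then have "connectedin (subtopology M (U \<inter> L)) (chart_inv c ` T)"
    using sub by (simp add: connectedin_subtopology)
  then have "chart_inv c y \<in> connected_component_of_set (subtopology M (U \<inter> L)) (chart_inv c x)"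
    using x y unfolding connected_component_of_def by blast
  also have "\<dots> = {q \<in> U. f q = f (chart_inv c x)}"
    using f L inv[OF x] unfolding fibres_are_plaques_def by blast
  finally show ?thesis by simp
qed

lemma constant_on_segment:
  assumes c: "foliated_chart M A pr F c" and f: "fibres_are_plaques M F U f" and v: "pr v = 0"
    and sub: "closed_segment y (y + t *\<^sub>R v) \<subseteq> coords c ` (U \<inter> dom_of c)"
  shows "(f \<circ> chart_inv c) (y + t *\<^sub>R v) = (f \<circ> chart_inv c) y"
proof -
  have "pr z = pr y" if z: "z \<in> closed_segment y (y + t *\<^sub>R v)" for z
  proof -
    obtain u where "z = (1 - u) *\<^sub>R y + u *\<^sub>R (y + t *\<^sub>R v)"
      using z unfolding closed_segment_def by blast
    then have "z = y + u *\<^sub>R (t *\<^sub>R v)" by (simp add: algebra_simps)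
    then show ?thesis using v by (simp add: linear_add[OF linear_pr] linear_cmul[OF linear_pr])
  qed
  then have "\<forall>z\<in>closed_segment y (y + t *\<^sub>R v). pr z = pr y" by blast
  then show ?thesis
    unfolding comp_def by (rule constant_on_plaque[OF c f connected_segment sub]) (rule ends_in_segment)+
qed

lemma derivative_along_leaf:
  assumes c: "foliated_chart M A pr F c" and f: "fibres_are_plaques M F U f" and U: "openin M U"
    and q: "q \<in> U" "q \<in> dom_of c" and v: "pr v = 0"
    and d: "(f \<circ> chart_inv c) differentiable (at (coords c q))"
  shows "frechet_derivative (f \<circ> chart_inv c) (at (coords c q)) v = 0"
proof (rule frechet_derivative_line_constant[OF d])
  let ?x = "coords c q"
  obtain r where r: "r > 0" "ball ?x r \<subseteq> coords c ` (U \<inter> dom_of c)"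
    using open_coords_image[OF foliated_chart_in_atlas[OF c] U] q
    by (metis IntI image_eqI open_contains_ball)
  have "\<forall>\<^sub>F t in at (0::real). ?x + t *\<^sub>R v \<in> ball ?x r"
    using r by (intro eventually_line_open) auto
  then show "\<forall>\<^sub>F t in at 0. (f \<circ> chart_inv c) (?x + t *\<^sub>R v) = (f \<circ> chart_inv c) ?x"
  proof eventually_elim
    case (elim t)
    have "closed_segment ?x (?x + t *\<^sub>R v) \<subseteq> ball ?x r"
      using elim r by (intro closed_segment_subset) auto
    then show ?case by (intro constant_on_segment[OF c f v] order.trans[OF _ r(2)])
  qed
qed

text \<open>\<open>vertical\<close> asks only for some foliated chart \<open>d\<close>. Passing to
  \<open>c\<close> works because the fibres of \<open>pr \<circ> coords c\<close> are plaques, so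
  its derivative, read in \<open>d\<close>, kills the kernel of \<open>pr\<close>.\<close>

lemma vertical_iff:
  assumes c: "foliated_chart M A pr F c" and q: "q \<in> dom_of c"
  shows "coord_vector A c q a \<in> vertical M A pr F q \<longleftrightarrow> pr a = 0"
proof
  have cq: "c \<in> charts_at A q" using c q by (simp add: charts_at_def foliated_chart_def)
  let ?v = "coord_vector A c q a"
  show "?v \<in> vertical M A pr F q" if "pr a = 0"
  proof -
    have "pr (?v c) = 0" using that cq by simp
    then show ?thesis unfolding vertical_def using c q coord_vector_tangent[OF cq] by blast
  qed
  assume "?v \<in> vertical M A pr F q"
  then obtain d where d: "foliated_chart M A pr F d" "q \<in> dom_of d" "pr (?v d) = 0"
    and tangent: "?v \<in> tangent_space A q" unfolding vertical_def by blast
  have dq: "d \<in> charts_at A q" using d by (simp add: charts_at_def foliated_chart_def)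
  let ?D = "frechet_derivative (transition d c) (at (coords d q))"
  have "((\<lambda>x. pr (transition d c x)) has_derivative (\<lambda>h. pr (?D h))) (at (coords d q))"
    by (rule bounded_linear.has_derivative[OF _ has_derivative_transition[OF dq cq]])
      (use linear_pr in \<open>simp add: linear_linear\<close>)
  then have D: "(((pr \<circ> coords c) \<circ> chart_inv d) has_derivative (\<lambda>h. pr (?D h))) (at (coords d q))"
    by (simp add: transition_def comp_def)
  have "fibres_are_plaques M F (dom_of c) (pr \<circ> coords c)" using c by (simp add: foliated_chart_def)
  from derivative_along_leaf[OF d(1) this openin_dom q d(2,3)] D
  have "pr (?D (?v d)) = 0"
    using foliated_chart_in_atlas[OF c] by (auto simp: frechet_derivative_eqI differentiable_def)
  moreover have "?v c = ?D (?v d)" using tangent cq dq unfolding tangent_space_def by blast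
  ultimately show "pr a = 0" using cq by simp
qed

lemma horizontalI:
  assumes c: "foliated_chart M A pr F c" and q: "q \<in> dom_of c"
    and X: "\<And>w. pr w = 0 \<Longrightarrow> coord_metric A g c (coords c q) X w = 0"
  shows "coord_vector A c q X \<in> horizontal M A pr F g q"
proof -
  have cA: "c \<in> A" by (rule foliated_chart_in_atlas[OF c])
  then have cq: "c \<in> charts_at A q" using q by (simp add: charts_at_def)
  have "g q (coord_vector A c q X) w = 0" if w: "w \<in> vertical M A pr F q" for w
  proof -
    have "w \<in> tangent_space A q" using w by (simp add: vertical_def)
    then have eq: "w = coord_vector A c q (w c)" by (rule tangent_coord_vector[OF cq])
    then have "pr (w c) = 0" using w vertical_iff[OF c q] by metis
    then have "g q (coord_vector A c q X) (coord_vector A c q (w c)) = 0"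
      using X[of "w c"] cA q by (simp add: coord_metric_def)
    then show ?thesis using eq by metis
  qed
  then show ?thesis using coord_vector_tangent[OF cq] by (simp add: horizontal_def)
qed

section \<open>Metrics and submersions in a foliated chart\<close>

lemma rescaled_metric:
  assumes c: "foliated_chart M A pr F c" and q: "q \<in> dom_of c"
    and resc: "vertical_rescaling M A pr F g\<^sub>0 \<phi> g"
    and X: "\<And>w. pr w = 0 \<Longrightarrow> coord_metric A g\<^sub>0 c (coords c q) X w = 0" and \<xi>: "pr \<xi> = 0"
  shows "coord_metric A g c (coords c q) (X + \<xi>) (X + \<xi>) =
    coord_metric A g\<^sub>0 c (coords c q) X X + exp (2 * \<phi> q) * coord_metric A g\<^sub>0 c (coords c q) \<xi> \<xi>"
proof -
  have cA: "c \<in> A" by (rule foliated_chart_in_atlas[OF c])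
  then have cq: "c \<in> charts_at A q" using q by (simp add: charts_at_def)
  have "q \<in> topspace M" using q openin_subset[OF openin_dom[OF cA]] by blast
  then show ?thesis
    using resc horizontalI[OF c q X] vertical_iff[OF c q, of \<xi>] \<xi> cA q
    unfolding vertical_rescaling_def by (simp add: coord_metric_def coord_vector_add[OF cq])
qed

lemma submersion_differentiable:
  assumes f: "riemannian_submersion A g U f h" and c: "c \<in> A" and q: "q \<in> U" "q \<in> dom_of c"
  shows "(f \<circ> chart_inv c) differentiable (at (coords c q))"
  using f c q unfolding riemannian_submersion_def smooth_map_on_def
  by (auto intro!: smooth_on_differentiable)

text \<open>A Riemannian submersion is isometric on vectors orthogonal to the kernel of its
  differential, whereas \<open>X\<close> is orthogonal to the kernel of \<open>pr\<close>. The two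
  kernels agree: \<open>f\<close> is constant along plaques, and the induced surjection of
  \<open>'b\<close> onto itself is injective.\<close>

lemma submersion_isometric:
  fixes f :: "'m \<Rightarrow> 'b"
  assumes c: "foliated_chart M A pr F c" and f: "fibres_are_plaques M F U f" and U: "openin M U"
    and sub: "riemannian_submersion A g U f h"
    and q: "q \<in> U" "q \<in> dom_of c"
    and X: "\<And>w. pr w = 0 \<Longrightarrow> coord_metric A g c (coords c q) X w = 0"
  defines "D \<equiv> frechet_derivative (f \<circ> chart_inv c) (at (coords c q))"
  shows "h (f q) (D X) (D X) = coord_metric A g c (coords c q) X X"
proof -
  have cA: "c \<in> A" by (rule foliated_chart_in_atlas[OF c])
  then have cq: "c \<in> charts_at A q" using q by (simp add: charts_at_def)
  note d = submersion_differentiable[OF sub cA q]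
  have linD: "linear D" unfolding D_def using d frechet_derivative_works has_derivative_linear by blast
  have diff: "differential c f q v = D (v c)" for v by (simp add: differential_def D_def)
  have range: "differential c f q ` tangent_space A q = UNIV"
    and iso: "\<And>v. v \<in> tangent_space A q \<Longrightarrow>
      (\<forall>w\<in>tangent_space A q. differential c f q w = 0 \<longrightarrow> g q v w = 0) \<Longrightarrow>
      h (f q) (differential c f q v) (differential c f q v) = g q v v"
    using sub q(1) cq unfolding riemannian_submersion_def by blast+
  have surjD': "surj D"
  proof -
    have "b \<in> range D" for b
    proof -
      have "b \<in> (\<lambda>v. D (v c)) ` tangent_space A q" using range unfolding diff by simp
      then show ?thesis by blast
    qed
    then show ?thesis by blast
  qed
  \<comment> \<open>For any linear section \<open>s\<close> of \<open>pr\<close>, the map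
    \<open>D\<close> factors through \<open>pr\<close> as \<open>D \<circ> s\<close>, because it
    kills the kernel of \<open>pr\<close>.\<close>
  obtain s where s: "linear s" "pr \<circ> s = id"
    using linear_surjective_right_inverse[OF linear_pr surj_pr] by blast
  have Ds: "D w = (D \<circ> s) (pr w)" for w
  proof -
    have "pr (w - s (pr w)) = 0"
      using s(2) by (metis comp_apply eq_id_iff linear_diff[OF linear_pr] right_minus_eq)
    then have "D (w - s (pr w)) = 0"
      unfolding D_def by (rule derivative_along_leaf[OF c f U q _ d])
    then show ?thesis by (simp add: linear_diff[OF linD])
  qed
  have "surj (D \<circ> s)"
  proof (rule surjI)
    fix y show "(D \<circ> s) (pr (inv D y)) = y" unfolding Ds[symmetric] by (rule surj_f_inv_f[OF surjD'])
  qed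
  then have inj: "inj (D \<circ> s)"
    using linear_surjective_imp_injective[OF linear_compose[OF s(1) linD]] by simp
  have ker: "pr w = 0" if "D w = 0" for w
  proof -
    have "(D \<circ> s) (pr w) = (D \<circ> s) 0"
      unfolding Ds[symmetric] using that by (simp add: linear_0[OF s(1)] linear_0[OF linD])
    then show ?thesis using inj by (rule injD[rotated])
  qed
  have "h (f q) (D X) (D X) = g q (coord_vector A c q X) (coord_vector A c q X)"
  proof -
    let ?X = "coord_vector A c q X"
    have "g q ?X w = 0" if w: "w \<in> tangent_space A q" "differential c f q w = 0" for w
    proof -
      have "pr (w c) = 0" using ker w(2) diff by simp
      then have "g q ?X (coord_vector A c q (w c)) = 0"
        using X[of "w c"] cA q by (simp add: coord_metric_def)
      then show ?thesis using tangent_coord_vector[OF cq w(1)] by metis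
    qed
    then show ?thesis
      using iso[OF coord_vector_tangent[OF cq, of X]] diff[of ?X] cq by simp
  qed
  then show ?thesis using cA q by (simp add: coord_metric_def)
qed

lemma constant_along_leaf_direction:
  assumes c: "foliated_chart M A pr F c" and \<phi>: "basic_function M A F \<phi>"
    and q: "q \<in> dom_of c" and r: "r \<in> dom_of c" and pr: "pr (coords c q) = pr (coords c r)"
  shows "\<phi> r = \<phi> q"
proof -
  have "q \<in> topspace M"
    using q openin_subset[OF openin_dom[OF foliated_chart_in_atlas[OF c]]] by blast
  then obtain L where L: "L \<in> F" "q \<in> L" using partition by (auto simp: partition_on_def)
  then have "r \<in> L" using foliated_chart_plaque[OF c L q r pr] by blast
  then show ?thesis using \<phi> L unfolding basic_function_def by metis
qed

text \<open>Constant coordinate fields are smooth and vertical on the whole chart, and their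
  covariant derivative is the Christoffel symbol alone.\<close>

lemma totally_geodesic_christoffel:
  assumes c: "foliated_chart M A pr F c" and geodesic: "totally_geodesic_leaves M A pr F g"
    and q: "q \<in> dom_of c" and v: "pr v = 0" and w: "pr w = 0"
  shows "pr (christoffel (coord_metric A g c) (coords c q) v w) = 0"
proof -
  have "coord_vector A c q (cov_deriv (coord_metric A g c) (\<lambda>_. v) (\<lambda>_. w) (coords c q))
      \<in> vertical M A pr F q"
    using geodesic foliated_chart_in_atlas[OF c] q vertical_iff[OF c] v w smooth_on_const
    unfolding totally_geodesic_leaves_def by blast
  then show ?thesis
    using vertical_iff[OF c q] by (simp add: cov_deriv_def frechet_derivative_eqI[OF has_derivative_const])
qed

text \<open>The rescaling prescribes a quadratic form only, so mixed values are recovered by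
  polarization: \<open>z\<close> and \<open>z + v\<close> share the same horizontal part
  \<open>X\<close>, and their squared lengths are compared.\<close>

lemma rescaled_metric_vertical:
  assumes c: "foliated_chart M A pr F c" and q: "q \<in> dom_of c"
    and g\<^sub>0: "riemannian_metric A g\<^sub>0" and resc: "vertical_rescaling M A pr F g\<^sub>0 \<phi> g" and v: "pr v = 0"
  shows "coord_metric A g c (coords c q) v z
    = exp (2 * \<phi> q) * coord_metric A g\<^sub>0 c (coords c q) v z"
proof -
  have cA: "c \<in> A" by (rule foliated_chart_in_atlas[OF c])
  let ?x = "coords c q" and ?G = "coord_metric A g c" and ?H = "coord_metric A g\<^sub>0 c"
  have x: "?x \<in> coords c ` dom_of c" using q by blast
  interpret h: metric_patch "coords c ` dom_of c" ?H
    by standard (use open_coords[OF cA] g\<^sub>0 cA in \<open>auto simp: riemannian_metric_def\<close>)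
  interpret metric_patch "coords c ` dom_of c" ?G
    by standard (use open_coords[OF cA] resc cA in \<open>auto simp: riemannian_metric_def vertical_rescaling_def\<close>)
  obtain X where X: "pr X = pr z" "\<And>w. pr w = 0 \<Longrightarrow> ?H ?x X w = 0"
    using h.horizontal_lift[OF x linear_pr surj_pr] by metis
  define \<xi> where "\<xi> = z - X"
  have \<xi>: "pr \<xi> = 0" "pr (\<xi> + v) = 0"
    using X(1) v by (simp_all add: \<xi>_def linear_add[OF linear_pr] linear_diff[OF linear_pr])
  have z: "z = X + \<xi>" by (simp add: \<xi>_def)
  let ?e = "exp (2 * \<phi> q)"
  have 1: "?G ?x (X + u) (X + u) = ?H ?x X X + ?e * ?H ?x u u" if "pr u = 0" for u
    by (rule rescaled_metric[OF c q resc _ that]) (rule X(2))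
  have 2: "?G ?x v v = ?e * ?H ?x v v"
  proof -
    have "?G ?x (0 + v) (0 + v) = ?H ?x 0 0 + ?e * ?H ?x v v"
      by (rule rescaled_metric[OF c q resc _ v]) (rule h.G_simps(9)[OF x])
    then show ?thesis by (simp add: h.G_simps(9)[OF x])
  qed
  have 3: "?G ?x (z + v) (z + v) = ?G ?x z z + 2 * ?G ?x v z + ?G ?x v v"
    using sym[OF x, of z v] by (simp add: G_simps(1,2)[OF x])
  have 4: "?H ?x (\<xi> + v) (\<xi> + v) = ?H ?x \<xi> \<xi> + 2 * ?H ?x v \<xi> + ?H ?x v v"
    using h.sym[OF x, of \<xi> v] by (simp add: h.G_simps(1,2)[OF x])
  have 5: "?H ?x v z = ?H ?x v \<xi>"
    using X(2)[OF v] h.sym[OF x, of v X] by (simp add: z h.G_simps(2)[OF x])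
  have "?G ?x (z + v) (z + v) = ?H ?x X X + ?e * ?H ?x (\<xi> + v) (\<xi> + v)"
    using 1[OF \<xi>(2)] by (simp add: z add.assoc)
  moreover have "?G ?x z z = ?H ?x X X + ?e * ?H ?x \<xi> \<xi>" using 1[OF \<xi>(1)] by (simp add: z)
  ultimately have "2 * ?G ?x v z = ?e * (2 * ?H ?x v \<xi>)"
    unfolding 2 3 4 by (simp add: distrib_left)
  then show ?thesis unfolding 5 by simp
qed

text \<open>Split \<open>a\<close> as \<open>X + \<xi>\<close> at \<open>x + t *\<^sub>R v\<close>.
  The differential of the local submersion is the same there as at \<open>x\<close>, so
  \<open>X\<close> keeps the length that \<open>a\<close> has at \<open>x\<close>. Hence
  \<open>\<xi>\<close> accounts for the growth of the squared length and for all inner products with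
  vertical vectors, and Cauchy-Schwarz for \<open>\<xi>\<close> and \<open>u\<close> is the
  claim.\<close>

lemma rescaled_horizontal_growth:
  assumes c: "foliated_chart M A pr F c" and p: "p \<in> dom_of c"
    and g\<^sub>0: "riemannian_metric A g\<^sub>0" and foliation: "riemannian_foliation M A pr F g\<^sub>0"
    and resc: "vertical_rescaling M A pr F g\<^sub>0 \<phi> g"
    and a: "\<forall>u. pr u = 0 \<longrightarrow> coord_metric A g c (coords c p) a u = 0" and v: "pr v = 0"
  defines "G \<equiv> coord_metric A g c" and "x \<equiv> coords c p"
  shows "\<forall>\<^sub>F t in at 0. \<forall>u. pr u = 0 \<longrightarrow>
    (G (x + t *\<^sub>R v) a u)\<^sup>2 \<le> (G (x + t *\<^sub>R v) a a - G x a a) * G (x + t *\<^sub>R v) u u"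
proof -
  have cA: "c \<in> A" by (rule foliated_chart_in_atlas[OF c])
  let ?H = "coord_metric A g\<^sub>0 c"
  interpret h: metric_patch "coords c ` dom_of c" ?H
    by standard (use open_coords[OF cA] g\<^sub>0 cA in \<open>auto simp: riemannian_metric_def\<close>)
  interpret metric_patch "coords c ` dom_of c" G
    by standard (use open_coords[OF cA] resc cA in
        \<open>auto simp: riemannian_metric_def vertical_rescaling_def G_def\<close>)
  note vert = rescaled_metric_vertical[OF c _ g\<^sub>0 resc, folded G_def]
  note formula = rescaled_metric[OF c _ resc, folded G_def]
  have x: "x \<in> coords c ` dom_of c" using p by (simp add: x_def)
  have p': "p \<in> topspace M" using p openin_subset[OF openin_dom[OF cA]] by blast
  obtain U f h where U: "openin M U" "p \<in> U" and sub: "riemannian_submersion A g\<^sub>0 U f h"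
    and f: "fibres_are_plaques M F U (f :: 'm \<Rightarrow> 'b)"
    using foliation p' unfolding riemannian_foliation_def by blast
  note iso = submersion_isometric[OF c f U(1) sub]
  let ?f = "f \<circ> chart_inv c"
  let ?D = "\<lambda>y. frechet_derivative ?f (at y)"
  obtain r where r: "r > 0" "ball x r \<subseteq> coords c ` (U \<inter> dom_of c)"
    using open_coords_image[OF cA U(1)] p U(2) unfolding x_def
    by (metis IntI image_eqI open_contains_ball)
  \<comment> \<open>Both metrics have the same horizontal vectors, since they are proportional as
    soon as one argument is vertical.\<close>
  have Ha: "?H x a u = 0" if "pr u = 0" for u
    using vert[OF p that, of a] a that sym[OF x, of a u] h.sym[OF x, of a u] by (simp add: G_def x_def)
  have base: "h (f p) (?D x a) (?D x a) = G x a a"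
    using iso[OF U(2) p, of a] Ha formula[OF p, of a 0] h.G_simps(9)[OF x] linear_0[OF linear_pr]
    by (simp add: x_def)
  \<comment> \<open>Convexity of the ball keeps the segment inside, so the invariance holds at every
    point of the ball, not only along the line through \<open>x\<close>; this allows it to be
    differentiated.\<close>
  have translate: "?f (y + t *\<^sub>R v) = ?f y" if "y \<in> ball x r" "y + t *\<^sub>R v \<in> ball x r" for y t
  proof -
    have "closed_segment y (y + t *\<^sub>R v) \<subseteq> ball x r"
      using that by (intro closed_segment_subset) auto
    then show ?thesis by (intro constant_on_segment[OF c f v] order.trans[OF _ r(2)])
  qed
  have "\<forall>\<^sub>F t in at (0::real). x + t *\<^sub>R v \<in> ball x r"
    using r by (intro eventually_line_open) auto
  then show ?thesis
  proof eventually_elim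
    case (elim t)
    define y where "y = x + t *\<^sub>R v"
    have "y \<in> coords c ` (U \<inter> dom_of c)" using elim r(2) by (auto simp: y_def)
    then obtain q where q: "q \<in> U" "q \<in> dom_of c" "coords c q = y" by blast
    have y: "y \<in> coords c ` dom_of c" using q by blast
    have "f q = f p"
      using translate[of x t] elim r(1) q p cA by (metis chart_inv_coords centre_in_ball comp_apply x_def y_def)
    have df: "(?f has_derivative ?D z) (at z)" if "z \<in> ball x r" for z
    proof -
      obtain s where "s \<in> U" "s \<in> dom_of c" "coords c s = z" using \<open>z \<in> ball x r\<close> r(2) by blast
      then show ?thesis
        using submersion_differentiable[OF sub cA] frechet_derivative_works by blast
    qed
    \<comment> \<open>The translation invariance of \<open>?f\<close> is differentiated at
      \<open>y\<close>; it holds on the open set \<open>?B\<close>, where both \<open>z\<close> and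
      its translate lie in the ball.\<close>
    have D: "?D y = ?D x"
    proof (rule frechet_derivative_eqI)
      have shift: "((\<lambda>z. z - t *\<^sub>R v) has_derivative (\<lambda>h. h)) (at y)"
        by (auto intro!: derivative_eq_intros)
      have "(?f has_derivative ?D x) (at (y - t *\<^sub>R v))" using df[of x] r(1) by (simp add: y_def)
      from has_derivative_compose[OF shift this]
      have sh: "((\<lambda>z. ?f (z - t *\<^sub>R v)) has_derivative ?D x) (at y)" .
      let ?B = "ball x r \<inter> (\<lambda>z. z - t *\<^sub>R v) -` ball x r"
      have "open ?B" by (intro open_Int open_vimage continuous_intros open_ball)
      then show "(?f has_derivative ?D x) (at y)"
      proof (rule has_derivative_transform_within_open[OF sh])
        show "y \<in> ?B" using elim r(1) by (simp add: y_def)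
        show "?f (z - t *\<^sub>R v) = ?f z" if "z \<in> ?B" for z
          using translate[of "z - t *\<^sub>R v" t] that by simp
      qed
    qed
    obtain X where X: "pr X = pr a" "\<And>w. pr w = 0 \<Longrightarrow> ?H y X w = 0"
      using h.horizontal_lift[OF y linear_pr surj_pr] by metis
    define \<xi> where "\<xi> = a - X"
    have \<xi>: "pr \<xi> = 0" using X(1) by (simp add: \<xi>_def linear_diff[OF linear_pr])
    have a_eq: "a = X + \<xi>" by (simp add: \<xi>_def)
    have lin: "linear (?D y)" using df[of y] elim has_derivative_linear by (auto simp: y_def)
    have "?D y \<xi> = 0"
      using derivative_along_leaf[OF c f U(1) q(1,2) \<xi> submersion_differentiable[OF sub cA q(1,2)]] q(3)
      by simp
    then have "?D y X = ?D x a" unfolding a_eq D[symmetric] by (simp add: linear_add[OF lin])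
    then have HX: "?H y X X = G x a a"
      using iso[OF q(1,2), of X] X(2) base \<open>f q = f p\<close> by (simp add: q(3))
    have G\<xi>: "G y \<xi> u = exp (2 * \<phi> q) * ?H y \<xi> u" for u
      using vert[OF q(2) \<xi>] by (simp add: q(3))
    have "G y a a = G x a a + G y \<xi> \<xi>"
      using formula[OF q(2) _ \<xi>, of X] X(2) HX G\<xi> by (simp add: q(3) a_eq)
    moreover have "G y a u = G y \<xi> u" if "pr u = 0" for u
      using vert[OF q(2) that, of X] X(2)[OF that] sym[OF y, of X u] h.sym[OF y, of X u]
      by (simp add: q(3) a_eq G_simps[OF y])
    ultimately show ?case using Cauchy_Schwarz[OF y, of \<xi>] by (simp add: y_def)
  qed
qed

end

section \<open>Reduction of the theorem to one foliated chart\<close>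

theorem corollary1p2:
  fixes M :: "'m topology"
    and A :: "('m, 'e::euclidean_space) chart set"
    and pr :: "'e \<Rightarrow> 'b::euclidean_space"
    and F :: "'m set set"
    and g\<^sub>0 g\<^sub>\<phi> :: "('m, 'e) metric_tensor"
    and \<phi> :: "'m \<Rightarrow> real"
  assumes "smooth_manifold M A" and "compact_space M" and "topspace M \<noteq> {}"
    and "riemannian_metric A g\<^sub>0"
    and "riemannian_foliation M A pr F g\<^sub>0"
    and "totally_geodesic_leaves M A pr F g\<^sub>0"
    and "basic_function M A F \<phi>"
    and "vertical_rescaling M A pr F g\<^sub>0 \<phi> g\<^sub>\<phi>"
    and "positively_curved A g\<^sub>\<phi>"
  shows "DIM('e) < 2 * DIM('b)"
proof -
  interpret foliated_manifold M A pr F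
  proof unfold_locales
    show "smooth_manifold M A" by (rule assms(1))
    show "foliation M A pr F" using assms(5) unfolding riemannian_foliation_def by blast
  qed
  have \<phi>: "smooth_map_on A (topspace M) \<phi>" using assms(7) by (simp add: basic_function_def)
  obtain p where p: "p \<in> topspace M" "\<And>q. q \<in> topspace M \<Longrightarrow> \<phi> p \<le> \<phi> q"
    using smooth_function_attains_inf[OF \<phi> assms(2,3)] by blast
  obtain c where c: "foliated_chart M A pr F c" and pc: "p \<in> dom_of c"
    using foliation p(1) unfolding foliation_def by blast
  have cA: "c \<in> A" by (rule foliated_chart_in_atlas[OF c])
  have dom: "dom_of c \<subseteq> topspace M" using openin_subset[OF openin_dom[OF cA]] .
  let ?S = "coords c ` dom_of c"
  let ?\<phi> = "\<phi> \<circ> chart_inv c"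
  let ?\<sigma> = "\<lambda>x. exp (2 * ?\<phi> x)"
  have smooth_\<phi>: "smooth_on ?S ?\<phi>"
  proof -
    have "smooth_on (coords c ` (topspace M \<inter> dom_of c)) ?\<phi>"
      using \<phi> cA unfolding smooth_map_on_def by blast
    then show ?thesis unfolding inf.absorb2[OF dom] .
  qed
  note d\<phi> = smooth_on_has_derivative[OF smooth_\<phi>]
  have d\<sigma>: "(?\<sigma> has_derivative (\<lambda>h. ?\<sigma> x * (2 * frechet_derivative ?\<phi> (at x) h))) (at x)"
    if "x \<in> ?S" for x
    by (rule has_derivative_eq_rhs[OF has_derivative_exp[OF has_derivative_mult_right[OF d\<phi>[OF that]]]])
      (rule ext, rule mult.commute)
  \<comment> \<open>The segment between the two points may leave \<open>?S\<close>; equality holds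
    because a whole level set of \<open>pr\<close> in the chart lies in one leaf.\<close>
  have leaf: "?\<phi> (x + t *\<^sub>R v) = ?\<phi> x" if "x \<in> ?S" "x + t *\<^sub>R v \<in> ?S" "pr v = 0" for x t v
    unfolding comp_def
  proof (rule constant_along_leaf_direction[OF c assms(7) chart_inv_in[OF that(1)] chart_inv_in[OF that(2)]])
    show "pr (coords c (chart_inv c x)) = pr (coords c (chart_inv c (x + t *\<^sub>R v)))"
      unfolding coords_chart_inv[OF that(1)] coords_chart_inv[OF that(2)]
      by (simp add: linear_add[OF linear_pr] linear_cmul[OF linear_pr] that(3))
  qed
  interpret warped_patch ?S "coord_metric A g\<^sub>0 c" "coord_metric A g\<^sub>\<phi> c" pr ?\<sigma> "coords c p"
  proof (intro warped_patch.intro metric_patch.intro warped_patch_axioms.intro)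
    show "open ?S" by (rule open_coords[OF cA])
    show "metric_on ?S (coord_metric A g\<^sub>0 c)" using assms(4) cA by (simp add: riemannian_metric_def)
    show "metric_on ?S (coord_metric A g\<^sub>\<phi> c)"
      using assms(8) cA by (simp add: riemannian_metric_def vertical_rescaling_def)
    show "linear pr" by (rule linear_pr)
    show "surj pr" by (rule surj_pr)
    show "coords c p \<in> ?S" using pc by blast
    show "coord_metric A g\<^sub>\<phi> c x v z = ?\<sigma> x * coord_metric A g\<^sub>0 c x v z"
      if "x \<in> ?S" "pr v = 0" for x v z
      using rescaled_metric_vertical[OF c _ assms(4,8) that(2)] that(1) cA by auto
    show "?\<sigma> differentiable (at x)" if "x \<in> ?S" for x
      using d\<sigma>[OF that] unfolding differentiable_def by blast
    show "(\<lambda>x. frechet_derivative ?\<sigma> (at x) h) differentiable (at (coords c p))" for h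
    proof -
      have x: "coords c p \<in> ?S" using pc by blast
      have "((\<lambda>x. frechet_derivative ?\<phi> (at x) h) has_derivative
          frechet_derivative (\<lambda>x. frechet_derivative ?\<phi> (at x) h) (at (coords c p))) (at (coords c p))"
        by (rule smooth_on_has_derivative[OF smooth_on_derivative[OF smooth_\<phi>] x])
      from has_derivative_mult[OF d\<sigma>[OF x] has_derivative_mult_right[OF this, of 2]]
      have "\<exists>D. ((\<lambda>x. ?\<sigma> x * (2 * frechet_derivative ?\<phi> (at x) h)) has_derivative D) (at (coords c p))"
        by blast
      then obtain D where
        "((\<lambda>x. ?\<sigma> x * (2 * frechet_derivative ?\<phi> (at x) h)) has_derivative D) (at (coords c p))" by blast
      then have "((\<lambda>x. frechet_derivative ?\<sigma> (at x) h) has_derivative D) (at (coords c p))"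
        by (rule has_derivative_transform_within_open[OF _ open_coords[OF cA] x])
          (simp only: frechet_derivative_eqI[OF d\<sigma>])
      then show ?thesis unfolding differentiable_def by blast
    qed
    show "?\<sigma> (coords c p) \<le> ?\<sigma> x" if "x \<in> ?S" for x
      using p(2) chart_inv_in[OF that] dom pc cA by auto
    show "frechet_derivative ?\<sigma> (at x) v = 0" if x: "x \<in> ?S" and v: "pr v = 0" for x v
    proof (rule frechet_derivative_line_constant)
      show "?\<sigma> differentiable (at x)" using d\<sigma>[OF x] unfolding differentiable_def by blast
      show "\<forall>\<^sub>F t in at 0. ?\<sigma> (x + t *\<^sub>R v) = ?\<sigma> x"
        using eventually_line_open[OF open_coords[OF cA] x, of v]
        by (rule eventually_mono) (rule arg_cong[OF leaf[OF x _ v]])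
    qed
    show "pr (christoffel (coord_metric A g\<^sub>0 c) x v w) = 0"
      if "x \<in> ?S" "pr v = 0" "pr w = 0" for x v w
      using totally_geodesic_christoffel[OF c assms(6) _ that(2,3)] that(1) by blast
    show "\<forall>\<^sub>F t in at 0. \<forall>u. pr u = 0 \<longrightarrow> (coord_metric A g\<^sub>\<phi> c (coords c p + t *\<^sub>R v) a u)\<^sup>2 \<le>
        (coord_metric A g\<^sub>\<phi> c (coords c p + t *\<^sub>R v) a a - coord_metric A g\<^sub>\<phi> c (coords c p) a a) *
        coord_metric A g\<^sub>\<phi> c (coords c p + t *\<^sub>R v) u u"
      if "\<forall>u. pr u = 0 \<longrightarrow> coord_metric A g\<^sub>\<phi> c (coords c p) a u = 0" "pr v = 0" for a v
      using rescaled_horizontal_growth[OF c pc assms(4,5,8) that] .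
  qed (rule open_coords[OF cA])
  show ?thesis
    using assms(9) cA pc unfolding positively_curved_def by (intro dimension_bound) blast
qed

end
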